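(* Let $K$ be a field, $M$ an affine monoid, and $x,y\in M$ noninvertible elements with $x\neq y$. Then the following statements (1) and (2) are equivalent: (1) $X^x-X^y$ generates a prime ideal in $K[M]$. (2) (a) $X^x,X^y$ is a $K[M]$-sequence; and (b) $\operatorname{gp}(M)/\mathbb{Z}(x-y)$ is torsionfree. Moreover, if $\varphi:M\to M'$ is a surjective homomorphism onto an affine monoid $M'$ with $\operatorname{rank} M'=\operatorname{rank} M-1$ and $\varphi(x)=\varphi(y)$, then (1) and (2) are equivalent to (3) $K[M']=K[M]/(X^x-X^y)$ under the induced homomorphism, i.e. the surjective $K$-algebra homomorphism $K[M]\to K[M']$, $X^z\mapsto X^{\varphi(z)}$, has kernel exactly $(X^x-X^y)$. Finally, if in this situation $M'$ is positively multigraded and $\varphi(z)\neq 0$ for all nonzero $z\in M$, then (1), (2) and (3) are equivalent to (4) $H_{M'}=(1-T^g)H_M$, where $M$ carries the induced grading $\deg z=\deg\varphi(z)$ and $g=\deg\varphi(x)$.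
   Context: An affine monoid is a finitely generated submonoid $M$ of some group $\mathbb{Z}^m$ (written additively). $\operatorname{gp}(M)\subset\mathbb{Z}^m$ is the subgroup generated by $M$, and $\operatorname{rank} M=\operatorname{rank}\operatorname{gp}(M)$. An element $x\in M$ is invertible if $-x\in M$. $K[M]$ is the monoid algebra, a subalgebra of the Laurent polynomial ring $K[\mathbb{Z}^m]$; $X^x$ denotes the monomial with exponent vector $x$. A sequence $f_1,\dots,f_n$ in a ring $R$ is an $R$-sequence (regular sequence) if each $f_i$ is a nonzerodivisor on $R/(f_1,\dots,f_{i-1})$ and $(f_1,\dots,f_n)\neq R$. A (multi)grading on an affine monoid $M$ is a $\mathbb{Z}$-linear map $\deg:\operatorname{gp}(M)\to\mathbb{Z}^e$ for some $e>0$. A monoid $N\subset \mathbb{Z}^e$ is positive if $u,-u\in N$ implies $u=0$. $M$ is positively (multi)graded if $\deg(M)$ is a positive submonoid of $\mathbb{Z}^e$ and the elements of $K\subset K[M]$ are the only ones of degree $0$ (i.e. $0$ is the only element of $M$ of degree $0$). Then $H(M,g)=\#\{z\in M:\deg z=g\}$ is finite for all $g$, and the Hilbert series is the formal Laurent series $H_M(T)=\sum_{g\in\mathbb{Z}^e}H(M,g)T^g$, where $T^g=T_1^{g_1}\cdots T_e^{g_e}$. *)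

theory Defs
  imports
    "HOL-Analysis.Finite_Cartesian_Product"
    "HOL-Library.Poly_Mapping"
    "HOL-Algebra.QuotRing"
    "HOL-Algebra.Generated_Groups"
begin

section \<open>Affine monoids\<close>

text \<open>The lattice of rank m is the type \<open>int ^ 'm\<close>. A subset closed under the operations
  becomes an object of HOL-Algebra, whose notation is multiplicative, as follows.\<close>

definition additive_monoid :: "'a::monoid_add set \<Rightarrow> 'a monoid" where
  "additive_monoid A = \<lparr>carrier = A, mult = (+), one = 0\<rparr>"

definition affine_monoid :: "(int ^ 'm) set \<Rightarrow> bool" where
  "affine_monoid M \<longleftrightarrow>
     (\<exists>S. finite S \<and> M = (\<lambda>N. submonoid N (additive_monoid UNIV)) hull S)"

definition gp :: "(int ^ 'm) set \<Rightarrow> (int ^ 'm) set" where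
  "gp M = generate (additive_monoid UNIV) M"

global_interpretation int_vec: module "(*s) :: int \<Rightarrow> int ^ 'm \<Rightarrow> int ^ 'm"
  by unfold_locales (simp_all add: vector_add_ldistrib vector_sadd_rdistrib vector_smult_assoc)

text \<open>The rank of an abelian group is the maximal size of a linearly independent subset over
  the integers; in \<open>int ^ 'm\<close> such sizes are bounded by \<open>CARD('m)\<close>, so the maximum exists.\<close>

definition group_rank :: "(int ^ 'm) set \<Rightarrow> nat" where
  "group_rank G = Max {card B | B. B \<subseteq> G \<and> finite B \<and> \<not> int_vec.dependent B}"

definition monoid_rank :: "(int ^ 'm) set \<Rightarrow> nat" where
  "monoid_rank M = group_rank (gp M)"

definition torsionfree :: "('a, 'b) monoid_scheme \<Rightarrow> bool" where
  "torsionfree G \<longleftrightarrow> (\<forall>a\<in>carrier G. \<forall>n::nat. n > 0 \<and> a [^]\<^bsub>G\<^esub> n = \<one>\<^bsub>G\<^esub> \<longrightarrow> a = \<one>\<^bsub>G\<^esub>)"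

section \<open>Monoid algebras\<close>

text \<open>The type \<open>'a \<Rightarrow>\<^sub>0 'k\<close> of finitely supported functions carries the convolution product; for
  \<open>'a = int ^ 'm\<close> it is the Laurent polynomial ring, and the algebra of \<open>M\<close> is
  its subring of elements supported in \<open>M\<close>.\<close>

definition monoid_algebra ::
    "'k::comm_ring_1 itself \<Rightarrow> 'a::comm_monoid_add set \<Rightarrow> ('a \<Rightarrow>\<^sub>0 'k) ring" where
  "monoid_algebra K M =
     \<lparr>carrier = {f. Poly_Mapping.keys f \<subseteq> M}, mult = (*), one = 1, zero = 0, add = (+)\<rparr>"

definition alg_monom :: "'a::comm_monoid_add \<Rightarrow> 'a \<Rightarrow>\<^sub>0 'k::comm_ring_1" where
  "alg_monom z = Poly_Mapping.single z 1"

text \<open>The \<open>K\<close>-linear map sending \<open>alg_monom z\<close> to \<open>alg_monom (\<phi> z)\<close>.\<close>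

definition monoid_algebra_map ::
    "('a::comm_monoid_add \<Rightarrow> 'b::comm_monoid_add) \<Rightarrow> ('a \<Rightarrow>\<^sub>0 'k::comm_ring_1) \<Rightarrow> ('b \<Rightarrow>\<^sub>0 'k)" where
  "monoid_algebra_map \<phi> f =
     (\<Sum>z\<in>Poly_Mapping.keys f. Poly_Mapping.single (\<phi> z) (Poly_Mapping.lookup f z))"

section \<open>Regular sequences\<close>

definition nonzerodivisor :: "('a, 'b) ring_scheme \<Rightarrow> 'a \<Rightarrow> bool" where
  "nonzerodivisor R r \<longleftrightarrow>
     r \<in> carrier R \<and> (\<forall>a\<in>carrier R. r \<otimes>\<^bsub>R\<^esub> a = \<zero>\<^bsub>R\<^esub> \<longrightarrow> a = \<zero>\<^bsub>R\<^esub>)"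

definition regular_sequence :: "('a, 'b) ring_scheme \<Rightarrow> 'a list \<Rightarrow> bool" where
  "regular_sequence R fs \<longleftrightarrow>
     set fs \<subseteq> carrier R \<and>
     (\<forall>i<length fs. let I = genideal R (set (take i fs))
        in nonzerodivisor (R Quot I) (I +>\<^bsub>R\<^esub> fs ! i)) \<and>
     genideal R (set fs) \<noteq> carrier R"

section \<open>Gradings and Hilbert series\<close>

definition positive_monoid :: "(int ^ 'e) set \<Rightarrow> bool" where
  "positive_monoid N \<longleftrightarrow> (\<forall>u. u \<in> N \<and> - u \<in> N \<longrightarrow> u = 0)"

text \<open>Only the values of the degree map on \<open>gp M\<close> matter; additive maps are the same as
  linear maps over the integers.\<close>

definition multigrading :: "(int ^ 'm) set \<Rightarrow> (int ^ 'm \<Rightarrow> int ^ 'e) \<Rightarrow> bool" where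
  "multigrading M deg \<longleftrightarrow> deg \<in> hom (additive_monoid (gp M)) (additive_monoid UNIV)"

definition positive_multigrading :: "(int ^ 'm) set \<Rightarrow> (int ^ 'm \<Rightarrow> int ^ 'e) \<Rightarrow> bool" where
  "positive_multigrading M deg \<longleftrightarrow>
     multigrading M deg \<and> positive_monoid (deg ` M) \<and> (\<forall>z\<in>M. deg z = 0 \<longrightarrow> z = 0)"

text \<open>A formal Laurent series with integer coefficients is its coefficient function
  \<open>int ^ 'e \<Rightarrow> int\<close>. Their supports are arbitrary, so they form a module
  over the Laurent polynomials but not a ring.\<close>

definition hilbert_series ::
    "(int ^ 'm) set \<Rightarrow> (int ^ 'm \<Rightarrow> int ^ 'e) \<Rightarrow> (int ^ 'e \<Rightarrow> int)" where
  "hilbert_series M deg = (\<lambda>g. int (card {z \<in> M. deg z = g}))"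

definition laurent_mult ::
    "((int ^ 'e) \<Rightarrow>\<^sub>0 int) \<Rightarrow> (int ^ 'e \<Rightarrow> int) \<Rightarrow> (int ^ 'e \<Rightarrow> int)" where
  "laurent_mult p H = (\<lambda>h. \<Sum>k\<in>Poly_Mapping.keys p. Poly_Mapping.lookup p k * H (h - k))"

end

theory Submission
  imports Defs "HOL-Analysis.Cartesian_Space"
begin

text \<open>Write \<open>d = x - y\<close>, \<open>G = gp M\<close>, and \<open>P\<close> for the ideal generated by \<open>X^x - X^y\<close>. All four
  conditions are translated into the combinatorics of moving by \<open>d\<close> inside the monoid \<open>M\<close>.

  Condition (a) concerns monomial ideals, so it can be tested on monomials: it says that
  \<open>z + y \<in> x + M\<close> implies \<open>z \<in> x + M\<close> (\<open>regular_sequence_iff\<close>). Iterating, whenever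
  \<open>z\<close> and \<open>w\<close> in \<open>M\<close> differ by \<open>k d\<close> with \<open>k > 0\<close>, one may subtract \<open>d\<close> from \<open>z\<close> without leaving
  \<open>M\<close>. Descending in this way from \<open>z\<close> to \<open>w\<close> shows that \<open>X^z - X^w\<close> lies in \<open>P\<close> as soon
  as \<open>z - w\<close> is a multiple of \<open>d\<close> (\<open>congruent_binomial_mem\<close>).

  If \<open>G/\<int>d\<close> is torsionfree, it embeds into a lattice, and the ring of Laurent polynomials is a domain,
  so the kernel of \<open>K[M] \<rightarrow> K[G/\<int>d]\<close> is prime. This kernel is spanned by the binomials \<open>X^z - X^w\<close>
  just considered, so it is \<open>P\<close>: the two conditions in (2) imply (1). Conversely, if \<open>P\<close> is prime, then
  \<open>z + y = x + w\<close> makes \<open>X^y (X^z - X^w)\<close> a multiple of \<open>X^x - X^y\<close>; as no monomial lies in \<open>P\<close>,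
  the second factor is such a multiple, and comparing cofactors gives (a). A torsion element
  \<open>a - b\<close> of order \<open>n\<close> in \<open>G/\<int>d\<close> would factor an element \<open>X^v (X^(na) - X^(nb))\<close> of \<open>P\<close> into
  factors none of which vanishes in \<open>K[G/\<int>d]\<close>, which gives (b).

  For \<open>\<phi>\<close> as in (3), the ranks force the kernel of the group homomorphism \<open>G \<rightarrow> gp M'\<close> to have rank 1;
  it contains \<open>d\<close>, so if \<open>G/\<int>d\<close> is torsionfree it equals \<open>\<int>d\<close>. Then the kernel of
  \<open>K[M] \<rightarrow> K[M']\<close> is again spanned by binomials from \<open>P\<close>. Conversely this kernel is always prime.

  For (4), call an element of \<open>M\<close> outside \<open>x + M\<close> terminal. Multiplying \<open>H\<^sub>M\<close> by \<open>1 - T^g\<close> removes the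
  contribution of \<open>x + M\<close> and leaves the number of terminal elements in each degree. Modulo \<open>P\<close> every
  monomial is congruent to a terminal one with the same image under \<open>\<phi>\<close>, so (4) says that
  \<open>\<phi>\<close> is injective on terminal elements, and this holds exactly when \<open>P\<close> contains all
  \<open>X^z - X^w\<close> with \<open>\<phi> z = \<phi> w\<close> (\<open>prime_iff_hilbert_series\<close>). The counting needs finite fibres of the
  degree map, which follow from Dickson's lemma in the form of \<open>hull_increasing_subseq\<close>.\<close>

section \<open>Linear maps induced by maps of exponents\<close>

lemma sum_single_keys: "f = (\<Sum>z\<in>Poly_Mapping.keys f. Poly_Mapping.single z (Poly_Mapping.lookup f z))"
  by (rule poly_mapping_eqI)
     (simp add: lookup_sum lookup_single when_def in_keys_iff sum.delta' sum.delta)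

lemma monoid_algebra_map_superset:
  assumes "finite A" "Poly_Mapping.keys f \<subseteq> A"
  shows "monoid_algebra_map \<phi> f = (\<Sum>z\<in>A. Poly_Mapping.single (\<phi> z) (Poly_Mapping.lookup f z))"
  unfolding monoid_algebra_map_def
  by (rule sum.mono_neutral_left) (use assms in \<open>auto simp: in_keys_iff\<close>)

lemma monoid_algebra_map_add:
  "monoid_algebra_map \<phi> (f + g) = monoid_algebra_map \<phi> f + monoid_algebra_map \<phi> g"
proof -
  let ?A = "Poly_Mapping.keys f \<union> Poly_Mapping.keys g"
  have "Poly_Mapping.keys (f + g) \<subseteq> ?A" by (rule keys_add)
  then show ?thesis
    by (simp add: monoid_algebra_map_superset[of ?A] lookup_add single_add sum.distrib)
qed

lemma monoid_algebra_map_zero [simp]: "monoid_algebra_map \<phi> 0 = 0"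
  by (simp add: monoid_algebra_map_def)

lemma monoid_algebra_map_single [simp]:
  "monoid_algebra_map \<phi> (Poly_Mapping.single z c) = Poly_Mapping.single (\<phi> z) c"
  by (simp add: monoid_algebra_map_def)

lemma monoid_algebra_map_alg_monom [simp]:
  "monoid_algebra_map \<phi> (alg_monom z) = alg_monom (\<phi> z)"
  by (simp add: alg_monom_def)

lemma monoid_algebra_map_diff:
  "monoid_algebra_map \<phi> (f - g) = monoid_algebra_map \<phi> f - monoid_algebra_map \<phi> g"
  by (metis add_diff_cancel_right' diff_add_cancel monoid_algebra_map_add)

lemma monoid_algebra_map_sum:
  "monoid_algebra_map \<phi> (\<Sum>i\<in>I. f i) = (\<Sum>i\<in>I. monoid_algebra_map \<phi> (f i))"
  by (induction I rule: infinite_finite_induct) (simp_all add: monoid_algebra_map_add)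

lemma monoid_algebra_map_comp:
  "monoid_algebra_map \<psi> (monoid_algebra_map \<phi> f) = monoid_algebra_map (\<psi> \<circ> \<phi>) f"
  by (simp add: monoid_algebra_map_def[of \<phi>] monoid_algebra_map_def[of "\<psi> \<circ> \<phi>"] monoid_algebra_map_sum)

lemma monoid_algebra_map_cong:
  assumes "Poly_Mapping.keys f \<subseteq> M" "\<And>z. z \<in> M \<Longrightarrow> \<phi> z = \<psi> z"
  shows "monoid_algebra_map \<phi> f = monoid_algebra_map \<psi> f"
  unfolding monoid_algebra_map_def by (rule sum.cong) (use assms in auto)

lemma monoid_algebra_map_ident:
  assumes "Poly_Mapping.keys f \<subseteq> M" "\<And>z. z \<in> M \<Longrightarrow> \<phi> z = z"
  shows "monoid_algebra_map \<phi> f = f"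
  using monoid_algebra_map_cong[OF assms(1), of \<phi> "\<lambda>z. z"] assms(2)
  by (simp add: monoid_algebra_map_def sum_single_keys[symmetric])

lemma monoid_algebra_map_mult:
  assumes "Poly_Mapping.keys f \<subseteq> M" "Poly_Mapping.keys g \<subseteq> M"
    and add: "\<And>z w. z \<in> M \<Longrightarrow> w \<in> M \<Longrightarrow> \<phi> (z + w) = \<phi> z + \<phi> w"
  shows "monoid_algebra_map \<phi> (f * g) = monoid_algebra_map \<phi> f * monoid_algebra_map \<phi> g"
proof -
  let ?f = "Poly_Mapping.lookup f" and ?g = "Poly_Mapping.lookup g"
  have "f * g = (\<Sum>z\<in>Poly_Mapping.keys f. Poly_Mapping.single z (?f z)) * (\<Sum>w\<in>Poly_Mapping.keys g. Poly_Mapping.single w (?g w))"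
    using sum_single_keys[of f] sum_single_keys[of g] by simp
  also have "\<dots> = (\<Sum>z\<in>Poly_Mapping.keys f. \<Sum>w\<in>Poly_Mapping.keys g. Poly_Mapping.single (z + w) (?f z * ?g w))"
    by (simp add: sum_product mult_single)
  finally have "monoid_algebra_map \<phi> (f * g) =
      (\<Sum>z\<in>Poly_Mapping.keys f. \<Sum>w\<in>Poly_Mapping.keys g. Poly_Mapping.single (\<phi> (z + w)) (?f z * ?g w))"
    by (simp add: monoid_algebra_map_sum)
  also have "\<dots> = (\<Sum>z\<in>Poly_Mapping.keys f. \<Sum>w\<in>Poly_Mapping.keys g.
      Poly_Mapping.single (\<phi> z) (?f z) * Poly_Mapping.single (\<phi> w) (?g w))"
  proof (intro sum.cong refl)
    fix z w assume "z \<in> Poly_Mapping.keys f" "w \<in> Poly_Mapping.keys g"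
    then have "z \<in> M" "w \<in> M" using assms(1,2) by auto
    then show "Poly_Mapping.single (\<phi> (z + w)) (?f z * ?g w) = Poly_Mapping.single (\<phi> z) (?f z) * Poly_Mapping.single (\<phi> w) (?g w)"
      by (simp add: mult_single add)
  qed
  finally show ?thesis by (simp add: monoid_algebra_map_def sum_product)
qed

lemma monoid_algebra_map_inj_eq_0:
  assumes "Poly_Mapping.keys f \<subseteq> M" "inj_on \<phi> M" "monoid_algebra_map \<phi> f = 0"
  shows "f = 0"
proof -
  have "f = monoid_algebra_map (inv_into M \<phi> \<circ> \<phi>) f"
    by (rule monoid_algebra_map_ident[symmetric, OF assms(1)]) (use assms(2) in auto)
  also have "\<dots> = 0" by (simp add: monoid_algebra_map_comp[symmetric] assms(3))
  finally show ?thesis .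
qed

lemma alg_monom_mult: "alg_monom a * alg_monom b = alg_monom (a + b)"
  by (simp add: alg_monom_def mult_single)

lemma alg_monom_inject [simp]: "alg_monom a = (alg_monom b :: 'a::comm_monoid_add \<Rightarrow>\<^sub>0 'k::comm_ring_1) \<longleftrightarrow> a = b"
  by (auto simp: alg_monom_def dest: arg_cong[where f = "\<lambda>f. Poly_Mapping.lookup f a"] simp: lookup_single when_def split: if_splits)

lemma alg_monom_neq_0 [simp]: "alg_monom a \<noteq> (0 :: 'a::comm_monoid_add \<Rightarrow>\<^sub>0 'k::comm_ring_1)"
  by (metis alg_monom_def lookup_single_eq lookup_zero zero_neq_one)

lemma alg_monom_zero: "alg_monom 0 = 1"
  by (simp add: alg_monom_def)

lemma keys_alg_monom [simp]: "Poly_Mapping.keys (alg_monom a :: 'a::comm_monoid_add \<Rightarrow>\<^sub>0 'k::comm_ring_1) = {a}"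
  by (simp add: alg_monom_def)

lemma alg_monom_power:
  fixes a :: "int ^ 'm"
  shows "alg_monom a ^ n = alg_monom (int n *s a)"
  by (induction n) (simp_all add: alg_monom_zero alg_monom_mult int_vec.scale_left_distrib)

text \<open>The linear order of \<open>nat \<Rightarrow>\<^sub>0 int\<close> is translation invariant, so the leading terms of two nonzero factors
  with exponents in this type have a nonzero product. The lattice embeds additively into it.\<close>

lemma laurent_no_zero_divisors:
  fixes p q :: "(int ^ 'n) \<Rightarrow>\<^sub>0 'k::idom"
  assumes "p * q = 0"
  shows "p = 0 \<or> q = 0"
proof -
  obtain e :: "'n \<Rightarrow> nat" where e: "inj e"
    using finite_imp_inj_to_nat_seg[of "UNIV :: 'n set"] by auto
  define \<epsilon> where "\<epsilon> v = (\<Sum>i\<in>UNIV. Poly_Mapping.single (e i) (v $ i))" for v :: "int ^ 'n"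
  have add: "\<epsilon> (v + w) = \<epsilon> v + \<epsilon> w" for v w
    by (simp add: \<epsilon>_def single_add sum.distrib)
  have "Poly_Mapping.lookup (\<epsilon> v) (e i) = v $ i" for v i
    using e by (simp add: \<epsilon>_def lookup_sum lookup_single when_def inj_eq)
  then have inj: "inj \<epsilon>"
    by (metis injI vec_eq_iff)
  have "monoid_algebra_map \<epsilon> p * monoid_algebra_map \<epsilon> q = 0"
    using monoid_algebra_map_mult[of p UNIV q \<epsilon>] add assms by simp
  then have "monoid_algebra_map \<epsilon> p = 0 \<or> monoid_algebra_map \<epsilon> q = 0" by simp
  then show ?thesis
    using monoid_algebra_map_inj_eq_0[OF subset_UNIV inj] by blast
qed

section \<open>Ideals of a monoid algebra\<close>

locale monoid_ring =
  fixes K :: "'k::idom itself" and M :: "'a::ab_group_add set"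
  assumes zero_mem: "0 \<in> M" and add_mem: "a \<in> M \<Longrightarrow> b \<in> M \<Longrightarrow> a + b \<in> M"
begin

abbreviation R :: "('a \<Rightarrow>\<^sub>0 'k) ring" where
  "R \<equiv> monoid_algebra K M"

lemma R_simps [simp]:
  "carrier R = {f. Poly_Mapping.keys f \<subseteq> M}" "mult R = (*)" "one R = 1" "zero R = 0" "add R = (+)"
  by (simp_all add: monoid_algebra_def)

lemma keys_mult_closed:
  assumes "Poly_Mapping.keys (f :: 'a \<Rightarrow>\<^sub>0 'k) \<subseteq> M" "Poly_Mapping.keys g \<subseteq> M"
  shows "Poly_Mapping.keys (f * g) \<subseteq> M"
  using keys_mult[of f g] assms add_mem by blast

lemma cring_R: "cring R"
proof (rule cringI)
  show "abelian_group R"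
  proof (rule abelian_groupI)
    show "f \<oplus>\<^bsub>R\<^esub> g \<in> carrier R" if "f \<in> carrier R" "g \<in> carrier R" for f g :: "'a \<Rightarrow>\<^sub>0 'k"
      using that keys_add[of f g] by auto
    fix f :: "'a \<Rightarrow>\<^sub>0 'k" assume "f \<in> carrier R"
    then show "\<exists>g\<in>carrier R. g \<oplus>\<^bsub>R\<^esub> f = \<zero>\<^bsub>R\<^esub>"
      by (intro bexI[of _ "- f"]) (auto simp: in_keys_iff)
  qed (simp_all add: add.assoc add.commute zero_mem)
  show "comm_monoid R"
  proof (rule comm_monoidI)
    show "f \<otimes>\<^bsub>R\<^esub> g \<in> carrier R" if "f \<in> carrier R" "g \<in> carrier R" for f g :: "'a \<Rightarrow>\<^sub>0 'k"
      using that keys_mult_closed by simp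
    show "\<one>\<^bsub>R\<^esub> \<in> carrier R"
      using zero_mem by simp
    show "f \<otimes>\<^bsub>R\<^esub> g \<otimes>\<^bsub>R\<^esub> h = f \<otimes>\<^bsub>R\<^esub> (g \<otimes>\<^bsub>R\<^esub> h)" for f g h :: "'a \<Rightarrow>\<^sub>0 'k"
      by (simp add: mult.assoc)
    show "f \<otimes>\<^bsub>R\<^esub> g = g \<otimes>\<^bsub>R\<^esub> f" for f g :: "'a \<Rightarrow>\<^sub>0 'k"
      by (simp only: R_simps mult.commute[of f g])
  qed simp
qed (simp add: distrib_right)

sublocale R: cring R by (rule cring_R)

lemma minus_closed:
  "Poly_Mapping.keys (f :: 'a \<Rightarrow>\<^sub>0 'k) \<subseteq> M \<Longrightarrow> Poly_Mapping.keys g \<subseteq> M \<Longrightarrow> Poly_Mapping.keys (f - g) \<subseteq> M"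
  using keys_diff[of f g] by blast

lemma R_a_inv:
  assumes "Poly_Mapping.keys (f :: 'a \<Rightarrow>\<^sub>0 'k) \<subseteq> M"
  shows "\<ominus>\<^bsub>R\<^esub> f = - f"
proof -
  have "Poly_Mapping.keys (- f) \<subseteq> M" using assms by (auto simp: in_keys_iff)
  then show ?thesis using assms R.minus_equality[of "- f" f] by simp
qed

lemma idealI_R:
  assumes sub: "\<And>f. f \<in> I \<Longrightarrow> Poly_Mapping.keys f \<subseteq> M" and zero: "0 \<in> I"
    and add: "\<And>f g. f \<in> I \<Longrightarrow> g \<in> I \<Longrightarrow> f + g \<in> I"
    and mult: "\<And>f g. f \<in> I \<Longrightarrow> Poly_Mapping.keys g \<subseteq> M \<Longrightarrow> g * f \<in> I"
  shows "ideal I R"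
proof (rule idealI)
  show "subgroup I (add_monoid R)"
  proof (rule group.subgroupI[OF R.a_group])
    fix f assume f: "f \<in> I"
    have "Poly_Mapping.keys (- 1 :: 'a \<Rightarrow>\<^sub>0 'k) \<subseteq> M" using zero_mem by (auto simp: in_keys_iff lookup_one when_def)
    from mult[OF f this] have "- f \<in> I" by simp
    then show "inv\<^bsub>add_monoid R\<^esub> f \<in> I" using R_a_inv[OF sub[OF f]] by (simp add: a_inv_def)
  qed (use sub zero add in auto)
  fix f g assume "f \<in> I" "g \<in> carrier R"
  then have "g * f \<in> I" using mult by simp
  then show "g \<otimes>\<^bsub>R\<^esub> f \<in> I" "f \<otimes>\<^bsub>R\<^esub> g \<in> I"
    by (simp_all only: R_simps mult.commute[of f g])
qed (rule R.ring_axioms)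

lemma ideal_closed:
  assumes "ideal I R"
  shows "\<And>f. f \<in> I \<Longrightarrow> Poly_Mapping.keys f \<subseteq> M" "0 \<in> I"
    "\<And>f g. f \<in> I \<Longrightarrow> g \<in> I \<Longrightarrow> f + g \<in> I"
    "\<And>f g. f \<in> I \<Longrightarrow> g \<in> I \<Longrightarrow> f - g \<in> I"
    "\<And>f g. f \<in> I \<Longrightarrow> Poly_Mapping.keys g \<subseteq> M \<Longrightarrow> g * f \<in> I"
proof -
  interpret I: ideal I R by fact
  show sub: "\<And>f. f \<in> I \<Longrightarrow> Poly_Mapping.keys f \<subseteq> M" using I.a_subset by auto
  show "0 \<in> I" using I.additive_subgroup_axioms additive_subgroup.zero_closed by force
  show add: "\<And>f g. f \<in> I \<Longrightarrow> g \<in> I \<Longrightarrow> f + g \<in> I" using I.a_closed by simp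
  show mult: "\<And>f g. f \<in> I \<Longrightarrow> Poly_Mapping.keys g \<subseteq> M \<Longrightarrow> g * f \<in> I" using I.I_l_closed by simp
  fix f g assume fg: "f \<in> I" "g \<in> I"
  then have "- g \<in> I" using I.a_inv_closed[OF fg(2)] R_a_inv[OF sub[OF fg(2)]] by simp
  with add[OF fg(1)] show "f - g \<in> I" by force
qed

lemma sum_mem_ideal:
  assumes "ideal I R" "\<And>i. i \<in> A \<Longrightarrow> f i \<in> I"
  shows "(\<Sum>i\<in>A. f i) \<in> I"
  using assms(2) by (induction A rule: infinite_finite_induct) (auto simp: ideal_closed[OF assms(1)])

lemma Idl_singleton:
  assumes "Poly_Mapping.keys p \<subseteq> M"
  shows "genideal R {p} = {h * p | h. Poly_Mapping.keys h \<subseteq> M}"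
  using R.cgenideal_eq_genideal[of p] assms by (auto simp: cgenideal_def)

definition map_kernel :: "('a \<Rightarrow> 'b::comm_monoid_add) \<Rightarrow> ('a \<Rightarrow>\<^sub>0 'k) set" where
  "map_kernel \<phi> = {f. Poly_Mapping.keys f \<subseteq> M \<and> monoid_algebra_map \<phi> f = 0}"

lemma ideal_map_kernel:
  assumes "\<And>z w. z \<in> M \<Longrightarrow> w \<in> M \<Longrightarrow> \<phi> (z + w) = \<phi> z + \<phi> w"
  shows "ideal (map_kernel \<phi>) R"
proof (rule idealI_R)
  fix f g :: "'a \<Rightarrow>\<^sub>0 'k"
  assume "f \<in> map_kernel \<phi>"
  then have f: "Poly_Mapping.keys f \<subseteq> M" "monoid_algebra_map \<phi> f = 0"
    by (auto simp: map_kernel_def)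
  show "f + g \<in> map_kernel \<phi>" if "g \<in> map_kernel \<phi>"
    using f that keys_add[of f g] by (auto simp: map_kernel_def monoid_algebra_map_add)
  show "g * f \<in> map_kernel \<phi>" if "Poly_Mapping.keys g \<subseteq> M"
    using f that by (simp add: map_kernel_def keys_mult_closed monoid_algebra_map_mult[OF _ _ assms])
qed (auto simp: map_kernel_def)

text \<open>The map induced by \<open>\<phi>\<close> takes values in a ring of Laurent polynomials, which is a domain.\<close>

lemma primeideal_map_kernel:
  fixes \<phi> :: "'a \<Rightarrow> int ^ 'n"
  assumes add: "\<And>z w. z \<in> M \<Longrightarrow> w \<in> M \<Longrightarrow> \<phi> (z + w) = \<phi> z + \<phi> w"
  shows "primeideal (map_kernel \<phi>) R"
proof (rule primeidealI)
  show "ideal (map_kernel \<phi>) R" using ideal_map_kernel add .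
  show "cring R" by (rule cring_R)
  have "alg_monom 0 \<in> carrier R" "alg_monom 0 \<notin> map_kernel \<phi>"
    using zero_mem by (auto simp: map_kernel_def)
  then show "carrier R \<noteq> map_kernel \<phi>" by blast
next
  fix f g :: "'a \<Rightarrow>\<^sub>0 'k"
  assume f: "f \<in> carrier R" and g: "g \<in> carrier R" and fg: "f \<otimes>\<^bsub>R\<^esub> g \<in> map_kernel \<phi>"
  then have "monoid_algebra_map \<phi> f * monoid_algebra_map \<phi> g = 0"
    using monoid_algebra_map_mult[of f M g \<phi>] add by (simp add: map_kernel_def)
  with laurent_no_zero_divisors f g show "f \<in> map_kernel \<phi> \<or> g \<in> map_kernel \<phi>"
    by (auto simp: map_kernel_def)
qed

text \<open>Choose a section \<open>s\<close> of \<open>\<phi>\<close>. Replacing every monomial \<open>X^z\<close> of \<open>f\<close> by \<open>X^(s (\<phi> z))\<close> changes \<open>f\<close> by an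
  element of \<open>I\<close>, and the result is the image under \<open>s\<close> of the image of \<open>f\<close> under \<open>\<phi>\<close>, hence 0.\<close>

lemma map_kernel_subset_ideal:
  assumes I: "ideal I R"
    and binomials: "\<And>z w. z \<in> M \<Longrightarrow> w \<in> M \<Longrightarrow> \<phi> z = \<phi> w \<Longrightarrow> alg_monom z - alg_monom w \<in> I"
  shows "map_kernel \<phi> \<subseteq> I"
proof
  fix f assume "f \<in> map_kernel \<phi>"
  then have f: "Poly_Mapping.keys f \<subseteq> M" "monoid_algebra_map \<phi> f = 0"
    by (auto simp: map_kernel_def)
  define t where "t = inv_into M \<phi> \<circ> \<phi>"
  have t: "t z \<in> M" "\<phi> z = \<phi> (t z)" if "z \<in> M" for z
    using that by (auto simp: t_def inv_into_into f_inv_into_f)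
  have "monoid_algebra_map t f = 0"
    unfolding t_def monoid_algebra_map_comp[symmetric] f by simp
  then have "f = f - monoid_algebra_map t f" by simp
  also have "\<dots> = (\<Sum>z\<in>Poly_Mapping.keys f. Poly_Mapping.single z (Poly_Mapping.lookup f z))
      - (\<Sum>z\<in>Poly_Mapping.keys f. Poly_Mapping.single (t z) (Poly_Mapping.lookup f z))"
    using sum_single_keys[of f] by (simp add: monoid_algebra_map_def)
  also have "\<dots> = (\<Sum>z\<in>Poly_Mapping.keys f. Poly_Mapping.single 0 (Poly_Mapping.lookup f z) * (alg_monom z - alg_monom (t z)))"
    by (simp add: sum_subtractf right_diff_distrib alg_monom_def mult_single)
  also have "\<dots> \<in> I"
  proof (rule sum_mem_ideal[OF I])
    fix z assume "z \<in> Poly_Mapping.keys f"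
    with f have "z \<in> M" by auto
    then show "Poly_Mapping.single 0 (Poly_Mapping.lookup f z) * (alg_monom z - alg_monom (t z)) \<in> I"
      using zero_mem by (intro ideal_closed(5)[OF I] binomials t) (auto split: if_splits)
  qed
  finally show "f \<in> I" .
qed

end

section \<open>Regular sequences of two monomials\<close>

lemma nonzerodivisor_Quot_iff:
  assumes "cring R" "ideal I R" "r \<in> carrier R"
  shows "nonzerodivisor (R Quot I) (I +>\<^bsub>R\<^esub> r) \<longleftrightarrow> (\<forall>a\<in>carrier R. r \<otimes>\<^bsub>R\<^esub> a \<in> I \<longrightarrow> a \<in> I)"
proof -
  interpret R: cring R by fact
  interpret I: ideal I R by fact
  have carrier: "carrier (R Quot I) = (\<lambda>a. I +>\<^bsub>R\<^esub> a) ` carrier R"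
    by (auto simp: FactRing_def A_RCOSETS_def')
  have zero: "I +>\<^bsub>R\<^esub> a = \<zero>\<^bsub>R Quot I\<^esub> \<longleftrightarrow> a \<in> I" if "a \<in> carrier R" for a
    using R.a_coset_join1[OF _ that I.a_subgroup] R.a_coset_join2[OF that I.a_subgroup]
    by (auto simp: FactRing_def)
  have mult: "(I +>\<^bsub>R\<^esub> r) \<otimes>\<^bsub>R Quot I\<^esub> (I +>\<^bsub>R\<^esub> a) = I +>\<^bsub>R\<^esub> (r \<otimes>\<^bsub>R\<^esub> a)" if "a \<in> carrier R" for a
    using that assms(3) by (simp add: FactRing_def I.rcoset_mult_add)
  show ?thesis
    unfolding nonzerodivisor_def using assms(3) by (simp add: carrier mult zero)
qed

lemma gp_eq_differences:
  fixes M :: "(int ^ 'm) set"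
  assumes zero: "0 \<in> M" and add: "\<And>a b. a \<in> M \<Longrightarrow> b \<in> M \<Longrightarrow> a + b \<in> M"
  shows "gp M = {a - b | a b. a \<in> M \<and> b \<in> M}"
proof -
  let ?Z = "additive_monoid (UNIV :: (int ^ 'm) set)"
  have grp: "group ?Z"
    by (rule groupI) (auto simp: additive_monoid_def add.assoc intro: exI[of _ "- _"])
  have inv: "inv\<^bsub>?Z\<^esub> a = - a" for a
    using group.inv_equality[OF grp, of "- a" a] by (simp add: additive_monoid_def)
  show ?thesis
  proof
    show "gp M \<subseteq> {a - b | a b. a \<in> M \<and> b \<in> M}"
    proof
      fix g assume "g \<in> gp M"
      then have "g \<in> generate ?Z M" by (simp add: gp_def)
      then show "g \<in> {a - b | a b. a \<in> M \<and> b \<in> M}"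
      proof induction
        case one
        then show ?case using zero by (force simp: additive_monoid_def)
      next
        case (incl h)
        then show ?case using zero by force
      next
        case (inv h)
        then show ?case using zero \<open>\<And>a. inv\<^bsub>?Z\<^esub> a = - a\<close> by force
      next
        case (eng h1 h2)
        then obtain a b a' b' where "a \<in> M" "b \<in> M" "a' \<in> M" "b' \<in> M" "h1 = a - b" "h2 = a' - b'" by blast
        moreover from this have "h1 \<otimes>\<^bsub>?Z\<^esub> h2 = (a + a') - (b + b')"
          by (simp add: additive_monoid_def)
        ultimately show ?case using add by blast
      qed
    qed
    show "{a - b | a b. a \<in> M \<and> b \<in> M} \<subseteq> gp M"
    proof clarify
      fix a b assume ab: "a \<in> M" "b \<in> M"
      then have "a \<otimes>\<^bsub>?Z\<^esub> (inv\<^bsub>?Z\<^esub> b) \<in> gp M"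
        unfolding gp_def by (intro generate.eng generate.incl generate.inv)
      then show "a - b \<in> gp M" unfolding inv by (simp add: additive_monoid_def)
    qed
  qed
qed

locale binomial = monoid_ring K M for K :: "'k::idom itself" and M :: "(int ^ 'm) set" +
  fixes x y :: "int ^ 'm"
  assumes x_mem: "x \<in> M" and y_mem: "y \<in> M"
    and x_noninv: "- x \<notin> M" and y_noninv: "- y \<notin> M" and neq: "x \<noteq> y"
begin

abbreviation P :: "((int ^ 'm) \<Rightarrow>\<^sub>0 'k) set" where
  "P \<equiv> genideal R {alg_monom x - alg_monom y}"

abbreviation D :: "(int ^ 'm) set" where
  "D \<equiv> range (\<lambda>k::int. k *s (x - y))"

text \<open>This is the statement that \<open>X^y\<close> is a nonzerodivisor modulo \<open>X^x\<close>, tested on monomials.\<close>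

definition shift_regular :: bool where
  "shift_regular \<longleftrightarrow> (\<forall>z\<in>M. z + y \<in> (+) x ` M \<longrightarrow> z \<in> (+) x ` M)"

text \<open>In the language of lattices, the subgroup generated by \<open>x - y\<close> is saturated in \<open>gp M\<close>, that is,
  the quotient is torsionfree.\<close>

definition saturated :: bool where
  "saturated \<longleftrightarrow> (\<forall>g\<in>gp M. \<forall>n::nat. n > 0 \<longrightarrow> int n *s g \<in> D \<longrightarrow> g \<in> D)"

lemma gp_M: "gp M = {a - b | a b. a \<in> M \<and> b \<in> M}"
  by (rule gp_eq_differences) (simp_all add: zero_mem add_mem)

lemma M_subset_gp: "M \<subseteq> gp M"
  using zero_mem by (force simp: gp_M)

lemma nat_scale_mem: "z \<in> M \<Longrightarrow> int n *s z \<in> M"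
  by (induction n) (simp_all add: zero_mem add_mem int_vec.scale_left_distrib)

lemma D_closed: "0 \<in> D" "g \<in> D \<Longrightarrow> h \<in> D \<Longrightarrow> g + h \<in> D" "g \<in> D \<Longrightarrow> - g \<in> D"
  "g \<in> D \<Longrightarrow> h \<in> D \<Longrightarrow> g - h \<in> D"
  by (auto simp: image_iff int_vec.scale_left_distrib[symmetric] int_vec.scale_minus_left[symmetric]
        int_vec.scale_left_diff_distrib[symmetric] simp del: int_vec.scale_minus_left
        intro: exI[of _ 0])

lemma D_subset_gp: "D \<subseteq> gp M"
proof -
  have "k *s (x - y) \<in> gp M" for k :: int
  proof (cases k rule: int_cases2)
    case (nonneg n)
    then show ?thesis using nat_scale_mem x_mem y_mem
      by (auto simp: gp_M int_vec.scale_right_diff_distrib)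
  next
    case (nonpos n)
    then have "k *s (x - y) = int n *s y - int n *s x"
      by (simp add: int_vec.scale_right_diff_distrib)
    then show ?thesis using nat_scale_mem x_mem y_mem by (auto simp: gp_M)
  qed
  then show ?thesis by auto
qed

lemma torsionfree_iff_saturated: "torsionfree (additive_monoid (gp M) Mod D) \<longleftrightarrow> saturated"
proof -
  let ?G = "additive_monoid (gp M)"
  have simps: "carrier ?G = gp M" "mult ?G = (+)" "one ?G = 0"
    by (simp_all add: additive_monoid_def)
  have "0 \<in> gp M" using zero_mem M_subset_gp by blast
  have gp_add: "g + h \<in> gp M" if gh: "g \<in> gp M" "h \<in> gp M" for g h
  proof -
    obtain a b a' b' where "a \<in> M" "b \<in> M" "a' \<in> M" "b' \<in> M" "g = a - b" "h = a' - b'"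
      using gh unfolding gp_M by blast
    then show ?thesis using add_mem[of a a'] add_mem[of b b'] unfolding gp_M
      by (intro CollectI exI[of _ "a + a'"] exI[of _ "b + b'"]) auto
  qed
  have gp_minus: "- g \<in> gp M" if "g \<in> gp M" for g
    using that unfolding gp_M by force
  have comm: "comm_group ?G"
  proof (rule comm_groupI)
    show "\<exists>h\<in>carrier ?G. h \<otimes>\<^bsub>?G\<^esub> g = \<one>\<^bsub>?G\<^esub>" if "g \<in> carrier ?G" for g
      using that gp_minus by (auto simp: simps intro!: bexI[of _ "- g"])
  qed (use gp_add \<open>0 \<in> gp M\<close> in \<open>auto simp: simps add.assoc add.commute\<close>)
  interpret G: comm_group ?G by fact
  have inv: "inv\<^bsub>?G\<^esub> g = - g" if "g \<in> gp M" for g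
    using G.inv_equality[of "- g" g] that gp_minus by (simp add: simps)
  have subgroup: "subgroup D ?G"
  proof (rule G.subgroupI)
    show "D \<subseteq> carrier ?G" using D_subset_gp by (simp add: simps)
    show "D \<noteq> {}" by blast
    show "inv\<^bsub>?G\<^esub> g \<in> D" if "g \<in> D" for g
      using inv[of g] that D_subset_gp D_closed(3) by auto
    show "g \<otimes>\<^bsub>?G\<^esub> h \<in> D" if "g \<in> D" "h \<in> D" for g h
      using that D_closed(2) by (simp add: simps)
  qed
  interpret N: normal D ?G
    by (rule G.subgroup_imp_normal[OF subgroup])
  have pow: "g [^]\<^bsub>?G\<^esub> n = int n *s g" for g and n :: nat
    by (induction n) (simp_all add: simps int_vec.scale_left_distrib add.commute)
  have one: "D #>\<^bsub>?G\<^esub> g = \<one>\<^bsub>?G Mod D\<^esub> \<longleftrightarrow> g \<in> D" if "g \<in> gp M" for g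
    using that G.coset_join1[OF _ _ subgroup, of g] G.coset_join2[OF _ subgroup, of g] N.subset
    by (auto simp: simps)
  have power: "(D #>\<^bsub>?G\<^esub> g) [^]\<^bsub>?G Mod D\<^esub> n = D #>\<^bsub>?G\<^esub> (int n *s g)" "int n *s g \<in> gp M" if "g \<in> gp M" for g and n :: nat
    using N.FactGroup_pow[of g n] G.nat_pow_closed[of g n] that by (simp_all add: simps pow)
  have "torsionfree (?G Mod D) \<longleftrightarrow> (\<forall>g\<in>gp M. \<forall>n::nat. n > 0 \<and>
      (D #>\<^bsub>?G\<^esub> g) [^]\<^bsub>?G Mod D\<^esub> n = \<one>\<^bsub>?G Mod D\<^esub> \<longrightarrow> D #>\<^bsub>?G\<^esub> g = \<one>\<^bsub>?G Mod D\<^esub>)"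
    unfolding torsionfree_def carrier_FactGroup simps by (simp only: ball_simps)
  also have "\<dots> \<longleftrightarrow> (\<forall>g\<in>gp M. \<forall>n::nat. n > 0 \<and> int n *s g \<in> D \<longrightarrow> g \<in> D)"
    by (intro ball_cong refl) (simp only: power one)
  finally show ?thesis unfolding saturated_def by blast
qed

lemma mem_Idl_alg_monom:
  assumes "v \<in> M"
  shows "f \<in> genideal R {alg_monom v} \<longleftrightarrow> Poly_Mapping.keys f \<subseteq> (+) v ` M"
proof
  assume "f \<in> genideal R {alg_monom v}"
  then obtain h where h: "f = h * alg_monom v" "Poly_Mapping.keys h \<subseteq> M"
    using assms Idl_singleton[of "alg_monom v"] by auto
  then show "Poly_Mapping.keys f \<subseteq> (+) v ` M"
    using keys_mult[of h "alg_monom v"] by (fastforce simp: add.commute)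
next
  assume f: "Poly_Mapping.keys f \<subseteq> (+) v ` M"
  have "f = (f * alg_monom (- v)) * alg_monom v"
    by (simp add: mult.assoc alg_monom_mult alg_monom_zero)
  moreover have "Poly_Mapping.keys (f * alg_monom (- v)) \<subseteq> M"
    using keys_mult[of f "alg_monom (- v)"] f by fastforce
  ultimately show "f \<in> genideal R {alg_monom v}"
    using assms Idl_singleton[of "alg_monom v"] by auto
qed

lemma keys_mult_alg_monom:
  "Poly_Mapping.keys (alg_monom v * f :: (int ^ 'm) \<Rightarrow>\<^sub>0 'k) = (+) v ` Poly_Mapping.keys f"
proof
  show "Poly_Mapping.keys (alg_monom v * f) \<subseteq> (+) v ` Poly_Mapping.keys f"
    using keys_mult[of "alg_monom v" f] by fastforce
  have "f = alg_monom (- v) * (alg_monom v * f)"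
    by (simp add: mult.assoc[symmetric] alg_monom_mult alg_monom_zero)
  then have "Poly_Mapping.keys f \<subseteq> (+) (- v) ` Poly_Mapping.keys (alg_monom v * f)"
    using keys_mult[of "alg_monom (- v)" "alg_monom v * f"] by fastforce
  then show "(+) v ` Poly_Mapping.keys f \<subseteq> Poly_Mapping.keys (alg_monom v * f)"
    by force
qed

text \<open>The polynomials supported in \<open>(x + M) \<union> (y + M)\<close> form an ideal containing both monomials, and 0 is
  not in this set of exponents because \<open>x\<close> and \<open>y\<close> are not invertible.\<close>

lemma Idl_monomials_proper: "genideal R {alg_monom x, alg_monom y} \<noteq> carrier R"
proof -
  let ?J = "{f :: (int ^ 'm) \<Rightarrow>\<^sub>0 'k. Poly_Mapping.keys f \<subseteq> (+) x ` M \<union> (+) y ` M}"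
  have absorb: "a + b \<in> (+) x ` M \<union> (+) y ` M" if ab: "a \<in> M" "b \<in> (+) x ` M \<union> (+) y ` M" for a b
  proof -
    obtain c v where "c \<in> M" "v \<in> {x, y}" "b = v + c" using ab(2) by blast
    then show ?thesis using add_mem[OF ab(1), of c] by (auto simp: add.left_commute)
  qed
  have "ideal ?J R"
  proof (rule idealI_R)
    fix f g :: "(int ^ 'm) \<Rightarrow>\<^sub>0 'k" assume f: "f \<in> ?J"
    have "(+) v ` M \<subseteq> M" if "v \<in> M" for v using that add_mem by blast
    then show "Poly_Mapping.keys f \<subseteq> M" using f x_mem y_mem by blast
    show "f + g \<in> ?J" if "g \<in> ?J" using f that keys_add[of f g] by blast
    show "g * f \<in> ?J" if "Poly_Mapping.keys g \<subseteq> M"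
      using f that keys_mult[of g f] absorb by (simp add: subset_iff) metis
  qed simp
  then have "genideal R {alg_monom x, alg_monom y} \<subseteq> ?J"
    by (rule R.genideal_minimal) (use zero_mem in force)
  moreover have "1 \<notin> ?J" using x_noninv y_noninv by (auto simp: add_eq_0_iff)
  moreover have "1 \<in> carrier R" using zero_mem by simp
  ultimately show ?thesis by blast
qed

text \<open>Since \<open>K[M]\<close> is a domain and the two monomials generate a proper ideal, only the second step of the
  sequence carries information. Membership in a monomial ideal depends on the support alone,
  so that step may be tested on monomials.\<close>

lemma regular_sequence_iff: "regular_sequence R [alg_monom x, alg_monom y] \<longleftrightarrow> shift_regular"
proof -
  have zero: "genideal R {} = {0}"
    using R.genideal_minimal[OF R.zeroideal, of "{}"] ideal_closed(2)[OF R.genideal_ideal[of "{}"]] by auto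
  have xc: "alg_monom x \<in> carrier R" and yc: "alg_monom y \<in> carrier R"
    using x_mem y_mem by auto
  have first: "nonzerodivisor (R Quot genideal R {}) (genideal R {} +>\<^bsub>R\<^esub> alg_monom x)"
    unfolding nonzerodivisor_Quot_iff[OF cring_R R.genideal_ideal[of "{}", simplified] xc]
    using laurent_no_zero_divisors[of "alg_monom x :: (int ^ 'm) \<Rightarrow>\<^sub>0 'k"] by (auto simp: zero)
  have "(\<forall>f\<in>carrier R. alg_monom y * f \<in> genideal R {alg_monom x} \<longrightarrow> f \<in> genideal R {alg_monom x})
      \<longleftrightarrow> shift_regular" (is "?L \<longleftrightarrow> _")
  proof
    assume L: ?L
    show shift_regular unfolding shift_regular_def
    proof (intro ballI impI)
      fix z assume "z \<in> M" "z + y \<in> (+) x ` M"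
      then have "alg_monom z \<in> genideal R {alg_monom x}"
        using L[rule_format, of "alg_monom z"] x_mem
        by (simp add: mem_Idl_alg_monom alg_monom_mult add.commute)
      then show "z \<in> (+) x ` M" using x_mem by (simp add: mem_Idl_alg_monom)
    qed
  next
    assume r: shift_regular
    show ?L
    proof (intro ballI impI)
      fix f assume f: "f \<in> carrier R" and "alg_monom y * f \<in> genideal R {alg_monom x}"
      then have "(+) y ` Poly_Mapping.keys f \<subseteq> (+) x ` M"
        using x_mem by (simp add: mem_Idl_alg_monom keys_mult_alg_monom)
      then have "Poly_Mapping.keys f \<subseteq> (+) x ` M"
        using r f unfolding shift_regular_def by (auto simp: add.commute subset_iff)
      then show "f \<in> genideal R {alg_monom x}" using x_mem by (simp add: mem_Idl_alg_monom)
    qed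
  qed
  then have second: "nonzerodivisor (R Quot genideal R {alg_monom x}) (genideal R {alg_monom x} +>\<^bsub>R\<^esub> alg_monom y)
      \<longleftrightarrow> shift_regular"
    using nonzerodivisor_Quot_iff[OF cring_R R.genideal_ideal yc, of "{alg_monom x}"] xc by simp
  show ?thesis
    unfolding regular_sequence_def Let_def using xc yc first second Idl_monomials_proper
    by (simp add: All_less_Suc2)
qed

section \<open>Primality forces regularity and torsionfreeness\<close>

lemma generator_closed: "Poly_Mapping.keys (alg_monom x - alg_monom y :: (int ^ 'm) \<Rightarrow>\<^sub>0 'k) \<subseteq> M"
  using minus_closed x_mem y_mem by simp

lemma ideal_P: "ideal P R"
  using R.genideal_ideal generator_closed by simp

lemma generator_mem: "alg_monom x - alg_monom y \<in> P"
  using R.genideal_self' generator_closed by simp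

lemma mem_P: "f \<in> P \<longleftrightarrow> (\<exists>h. f = h * (alg_monom x - alg_monom y) \<and> Poly_Mapping.keys h \<subseteq> M)"
  using Idl_singleton[OF generator_closed] by auto

text \<open>A map of exponents that identifies \<open>z + x\<close> with \<open>z + y\<close> kills every multiple of \<open>X^x - X^y\<close>. The
  map may be a choice of coset representatives, which is rarely additive.\<close>

lemma P_collapses:
  assumes "f \<in> P" and \<pi>: "\<And>z. z \<in> M \<Longrightarrow> \<pi> (z + x) = \<pi> (z + y)"
  shows "monoid_algebra_map \<pi> f = 0"
proof -
  obtain h where h: "f = h * (alg_monom x - alg_monom y)" "Poly_Mapping.keys h \<subseteq> M"
    using assms(1) mem_P by blast
  have "f = (\<Sum>z\<in>Poly_Mapping.keys h. Poly_Mapping.single z (Poly_Mapping.lookup h z)) * (alg_monom x - alg_monom y)"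
    using h(1) sum_single_keys[of h] by simp
  also have "\<dots> = (\<Sum>z\<in>Poly_Mapping.keys h. Poly_Mapping.single (z + x) (Poly_Mapping.lookup h z) -
      Poly_Mapping.single (z + y) (Poly_Mapping.lookup h z))"
    unfolding sum_distrib_right by (simp add: right_diff_distrib alg_monom_def mult_single)
  finally have "f = (\<Sum>z\<in>Poly_Mapping.keys h. Poly_Mapping.single (z + x) (Poly_Mapping.lookup h z) -
      Poly_Mapping.single (z + y) (Poly_Mapping.lookup h z))" .
  then show ?thesis
    using \<pi> h(2) by (simp add: monoid_algebra_map_sum monoid_algebra_map_diff subset_iff)
qed

text \<open>Sending all exponents to 0 amounts to taking the sum of the coefficients, which vanishes on \<open>P\<close>.\<close>

lemma alg_monom_notin_P: "alg_monom z \<notin> P"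
  using P_collapses[of "alg_monom z" "\<lambda>_. 0 :: int"] by auto

text \<open>If \<open>z + y = x + w\<close>, then \<open>X^y (X^z - X^w) = X^w (X^x - X^y)\<close> lies in \<open>P\<close>, hence so does \<open>X^z - X^w\<close>. Its
  cofactor with respect to \<open>X^x - X^y\<close> is \<open>X^(w - y)\<close>, and since that cofactor belongs to \<open>K[M]\<close>,
  \<open>w - y\<close> belongs to \<open>M\<close>; but \<open>z = x + (w - y)\<close>.\<close>

lemma prime_imp_shift_regular:
  assumes "primeideal P R"
  shows shift_regular
  unfolding shift_regular_def
proof (intro ballI impI)
  interpret P: primeideal P R by fact
  let ?q = "alg_monom x - alg_monom y :: (int ^ 'm) \<Rightarrow>\<^sub>0 'k"
  fix z assume z: "z \<in> M" "z + y \<in> (+) x ` M"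
  then obtain w where w: "w \<in> M" "z + y = x + w" by auto
  have "alg_monom y * (alg_monom z - alg_monom w) = alg_monom w * ?q"
    using w(2) by (simp add: right_diff_distrib alg_monom_mult add.commute)
  also have "\<dots> \<in> P" using ideal_closed(5)[OF ideal_P generator_mem] w by simp
  finally have "alg_monom z - alg_monom w \<in> P"
    using P.I_prime[of "alg_monom y" "alg_monom z - alg_monom w"] alg_monom_notin_P y_mem
      minus_closed[of "alg_monom z" "alg_monom w"] z w by auto
  then obtain h where h: "alg_monom z - alg_monom w = h * ?q" "Poly_Mapping.keys h \<subseteq> M"
    unfolding mem_P by blast
  have "w - y + x = z" using w(2) by (simp add: algebra_simps)
  then have "alg_monom (w - y) * ?q = alg_monom z - alg_monom w"
    by (simp add: right_diff_distrib alg_monom_mult)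
  then have "(h - alg_monom (w - y)) * ?q = 0"
    using h(1) by (simp add: left_diff_distrib)
  then have "h = alg_monom (w - y)"
    using laurent_no_zero_divisors[of "h - alg_monom (w - y)" ?q] neq by simp
  then have "w - y \<in> M" using h(2) by simp
  moreover have "z = x + (w - y)" using w(2) by (simp add: algebra_simps)
  ultimately show "z \<in> (+) x ` M" by blast
qed

lemma power_binomial_mem: "alg_monom x ^ n - alg_monom y ^ n \<in> P"
proof -
  have pow: "Poly_Mapping.keys (alg_monom z ^ n :: (int ^ 'm) \<Rightarrow>\<^sub>0 'k) \<subseteq> M" if "z \<in> M" for z n
    by (induction n) (use that zero_mem keys_mult_closed in simp_all)
  let ?S = "\<Sum>i<n. alg_monom y ^ (n - Suc i) * alg_monom x ^ i :: (int ^ 'm) \<Rightarrow>\<^sub>0 'k"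
  have "Poly_Mapping.keys (alg_monom y ^ (n - Suc i) * alg_monom x ^ i :: (int ^ 'm) \<Rightarrow>\<^sub>0 'k) \<subseteq> M" for i
    by (intro keys_mult_closed pow x_mem y_mem)
  then have "Poly_Mapping.keys ?S \<subseteq> M"
    by (intro order.trans[OF keys_sum] UN_least)
  then show ?thesis
    unfolding power_diff_sumr2 using ideal_closed(5)[OF ideal_P generator_mem] by (subst mult.commute)
qed

text \<open>If \<open>z - w = n d\<close>, then \<open>z + n y = w + n x\<close>, so multiplication by \<open>X^(n y)\<close> turns \<open>X^z - X^w\<close> into a
  monomial times \<open>(X^x)^n - (X^y)^n\<close>.\<close>

lemma congruent_binomial_multiple_mem:
  assumes "z \<in> M" "w \<in> M" "z - w \<in> D"
  shows "\<exists>v\<in>M. alg_monom v * (alg_monom z - alg_monom w) \<in> P"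
proof -
  have *: "\<exists>v\<in>M. alg_monom v * (alg_monom z - alg_monom w) \<in> P"
    if "z \<in> M" "w \<in> M" "z - w = int n *s (x - y)" for z w n
  proof (intro bexI)
    show "int n *s y \<in> M" using nat_scale_mem y_mem .
    have "int n *s y + z = w + int n *s x"
      using that(3) by (simp add: int_vec.scale_right_diff_distrib algebra_simps)
    then have "alg_monom (int n *s y) * (alg_monom z - alg_monom w) = alg_monom w * (alg_monom x ^ n - alg_monom y ^ n)"
      by (simp add: alg_monom_power right_diff_distrib alg_monom_mult add.commute)
    also have "\<dots> \<in> P" using ideal_closed(5)[OF ideal_P power_binomial_mem] that by simp
    finally show "alg_monom (int n *s y) * (alg_monom z - alg_monom w) \<in> P" .
  qed
  obtain k where k: "z - w = k *s (x - y)" using assms(3) by auto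
  show ?thesis
  proof (cases k rule: int_cases2)
    case (nonneg n)
    then show ?thesis using *[of z w n] assms k by simp
  next
    case (nonpos n)
    then have "w - z = int n *s (x - y)" using k by (simp add: algebra_simps)
    then obtain v where "v \<in> M" "alg_monom v * (alg_monom w - alg_monom z) \<in> P"
      using *[of w z n] assms by blast
    then show ?thesis
      using ideal_closed(4)[OF ideal_P ideal_closed(2)[OF ideal_P]] by (force simp: right_diff_distrib)
  qed
qed

text \<open>A choice of representatives replaces the projection to the quotient by \<open>D\<close>: two exponents have equal
  representatives exactly when they are congruent, and the values stay in the lattice.\<close>

definition coset_rep :: "int ^ 'm \<Rightarrow> int ^ 'm" where
  "coset_rep z = (SOME w. w - z \<in> D)"

lemma coset_rep_eq_iff: "coset_rep z = coset_rep w \<longleftrightarrow> z - w \<in> D"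
proof
  have rep: "coset_rep z - z \<in> D" for z
    unfolding coset_rep_def by (rule someI[of _ z]) (use D_closed(1) in simp)
  show "z - w \<in> D" if "coset_rep z = coset_rep w"
    using D_closed(4)[OF rep[of w] rep[of z]] that by simp
  assume zw: "z - w \<in> D"
  have "v - z \<in> D \<longleftrightarrow> v - w \<in> D" for v
    using D_closed(2)[OF _ zw, of "v - z"] D_closed(4)[OF _ zw, of "v - w"] by auto
  then show "coset_rep z = coset_rep w" by (simp add: coset_rep_def)
qed

text \<open>Let \<open>g = a - b\<close> have order \<open>n > 1\<close> modulo \<open>D\<close>. A monomial multiple of
  \<open>X^(n a) - X^(n b) = (X^a - X^b) (\<Sum>i<n. X^(i a + (n - 1 - i) b))\<close> lies in \<open>P\<close>. The exponents in each factor
  are pairwise incongruent modulo \<open>D\<close>, so neither factor vanishes after passing to cosets, while elements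
  of \<open>P\<close> do. Coefficients are compared instead of summed because the sum \<open>n\<close> of those of the
  second factor may vanish in \<open>K\<close>.\<close>

lemma prime_imp_saturated:
  assumes "primeideal P R"
  shows saturated
proof (rule ccontr)
  interpret P: primeideal P R by fact
  assume "\<not> saturated"
  then obtain g where g: "g \<in> gp M" "g \<notin> D" and ex: "\<exists>n::nat. n > 0 \<and> int n *s g \<in> D"
    unfolding saturated_def by blast
  obtain a b where ab: "a \<in> M" "b \<in> M" "g = a - b" using g(1) by (auto simp: gp_M)
  define n where "n = (LEAST n::nat. n > 0 \<and> int n *s g \<in> D)"
  have n: "n > 0" "int n *s g \<in> D" using LeastI_ex[OF ex] by (auto simp: n_def)
  have "x - y \<in> D" by (rule range_eqI[of _ _ 1]) simp
  then have collapse: "monoid_algebra_map coset_rep f = 0" if "f \<in> P" for f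
    by (intro P_collapses[OF that]) (simp add: coset_rep_eq_iff)
  have least: "i = 0" if "i < n" "int i *s g \<in> D" for i
    using that not_less_Least[of i "\<lambda>n. n > 0 \<and> int n *s g \<in> D"] by (auto simp: n_def)
  define S where "S = (\<Sum>i<n. alg_monom b ^ (n - Suc i) * alg_monom a ^ i :: (int ^ 'm) \<Rightarrow>\<^sub>0 'k)"
  have S: "S = (\<Sum>i<n. alg_monom (int (n - Suc i) *s b + int i *s a))"
    by (simp add: S_def alg_monom_power alg_monom_mult)
  have S_closed: "Poly_Mapping.keys S \<subseteq> M"
    unfolding S by (intro order.trans[OF keys_sum] UN_least)
      (simp only: keys_alg_monom insert_subset empty_subsetI nat_scale_mem ab add_mem simp_thms)
  have "int n *s a - int n *s b \<in> D"
    using n(2) by (simp add: ab int_vec.scale_right_diff_distrib)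
  then obtain v where v: "v \<in> M" "alg_monom v * (alg_monom (int n *s a) - alg_monom (int n *s b)) \<in> P"
    using congruent_binomial_multiple_mem[of "int n *s a" "int n *s b"] nat_scale_mem ab by blast
  have "alg_monom (int n *s a) - alg_monom (int n *s b) = (alg_monom a - alg_monom b) * S"
    by (simp add: alg_monom_power[symmetric] power_diff_sumr2 S_def)
  then have "alg_monom v * ((alg_monom a - alg_monom b) * S) \<in> P"
    using v(2) by simp
  then have "(alg_monom a - alg_monom b) * S \<in> P"
    using P.I_prime[of "alg_monom v" "(alg_monom a - alg_monom b) * S"] alg_monom_notin_P v(1)
      S_closed minus_closed[of "alg_monom a" "alg_monom b"] keys_mult_closed ab by auto
  then consider "alg_monom a - alg_monom b \<in> P" | "S \<in> P"
    using P.I_prime[of "alg_monom a - alg_monom b" S] S_closed minus_closed[of "alg_monom a" "alg_monom b"] ab by auto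
  then show False
  proof cases
    case 1
    have "alg_monom (coset_rep a) - alg_monom (coset_rep b) = (0 :: (int ^ 'm) \<Rightarrow>\<^sub>0 'k)"
      using collapse[OF 1] by (simp add: monoid_algebra_map_diff)
    then show False using g(2) ab by (simp add: coset_rep_eq_iff)
  next
    case 2
    have "0 = Poly_Mapping.lookup (monoid_algebra_map coset_rep S) (coset_rep (int (n - 1) *s b))"
      by (simp add: collapse[OF 2])
    \<comment> \<open>of the exponents in \<open>S\<close> only the one for \<open>i = 0\<close> is congruent to \<open>(n - 1) b\<close>\<close>
    also have "\<dots> = (\<Sum>i<n. if i = 0 then 1 else 0)"
      unfolding S monoid_algebra_map_sum lookup_sum
    proof (rule sum.cong)
      fix i assume i: "i \<in> {..<n}"
      then have "int (n - Suc i) *s b + int i *s a - int (n - 1) *s b = int i *s g"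
        by (simp add: ab of_nat_diff algebra_simps int_vec.scale_left_diff_distrib int_vec.scale_left_distrib
              int_vec.scale_right_diff_distrib)
      then have "coset_rep (int (n - Suc i) *s b + int i *s a) = coset_rep (int (n - 1) *s b) \<longleftrightarrow> i = 0"
        using coset_rep_eq_iff[of "int (n - Suc i) *s b + int i *s a" "int (n - 1) *s b"] least[of i] i D_closed(1) by auto
      then show "Poly_Mapping.lookup (monoid_algebra_map coset_rep (alg_monom (int (n - Suc i) *s b + int i *s a)))
          (coset_rep (int (n - 1) *s b)) = (if i = 0 then 1 else 0 :: 'k)"
        by (simp add: alg_monom_def lookup_single when_def)
    qed simp
    also have "\<dots> = 1" using n(1) by simp
    finally show False by simp
  qed
qed

section \<open>Regularity and torsionfreeness imply primality\<close>

text \<open>From \<open>z + (n + 1) y = x + (w + n x)\<close> the regularity condition cancels one \<open>y\<close> at a time.\<close>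

lemma shift_regular_iterated:
  assumes shift_regular "z \<in> M" "w \<in> M" "z - w = int (Suc n) *s (x - y)"
  shows "z \<in> (+) x ` M"
proof -
  have descend: "z \<in> (+) x ` M" if "z + int j *s y \<in> (+) x ` M" for j
    using that
  proof (induction j)
    case (Suc j)
    have "z + int j *s y \<in> M" using assms(2) nat_scale_mem[OF y_mem] add_mem by blast
    moreover have "z + int j *s y + y \<in> (+) x ` M"
      using Suc.prems by (simp add: int_vec.scale_left_distrib algebra_simps)
    ultimately show ?case using assms(1) Suc.IH unfolding shift_regular_def by blast
  qed simp
  have "z + int (Suc n) *s y = x + (w + int n *s x)"
    using assms(4) by (simp add: algebra_simps int_vec.scale_left_distrib int_vec.scale_right_diff_distrib)
  moreover have "w + int n *s x \<in> M" using assms(3) nat_scale_mem[OF x_mem] add_mem by blast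
  ultimately show ?thesis by (intro descend[of "Suc n"]) auto
qed

text \<open>With \<open>z = x + u\<close>, the monomial \<open>X^z\<close> is congruent to \<open>X^(u + y)\<close> modulo \<open>P\<close>, and \<open>u + y = z - d\<close> is one step
  closer to \<open>w\<close>.\<close>

lemma congruent_binomial_mem:
  assumes shift_regular "z \<in> M" "w \<in> M" "z - w \<in> D"
  shows "alg_monom z - alg_monom w \<in> P"
proof -
  have *: "alg_monom z - alg_monom w \<in> P" if "z \<in> M" "w \<in> M" "z - w = int n *s (x - y)" for z w n
    using that
  proof (induction n arbitrary: z)
    case 0
    then show ?case using ideal_closed(2)[OF ideal_P] by simp
  next
    case (Suc n)
    obtain u where u: "u \<in> M" "z = x + u" using shift_regular_iterated[OF assms(1) Suc.prems] by auto
    have "u + y - w = int n *s (x - y)"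
      using Suc.prems(3) u by (simp add: algebra_simps int_vec.scale_left_distrib)
    then have "alg_monom (u + y) - alg_monom w \<in> P" using Suc.IH u y_mem add_mem Suc.prems by simp
    moreover have "alg_monom u * (alg_monom x - alg_monom y) \<in> P"
      using ideal_closed(5)[OF ideal_P generator_mem] u by simp
    moreover have "alg_monom z - alg_monom w = alg_monom u * (alg_monom x - alg_monom y) + (alg_monom (u + y) - alg_monom w :: (int ^ 'm) \<Rightarrow>\<^sub>0 'k)"
      using u by (simp add: right_diff_distrib alg_monom_mult add.commute)
    ultimately show ?case using ideal_closed(3)[OF ideal_P] by metis
  qed
  obtain k where k: "z - w = k *s (x - y)" using assms(4) by auto
  show ?thesis
  proof (cases k rule: int_cases2)
    case (nonneg n)
    then show ?thesis using * assms k by blast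
  next
    case (nonpos n)
    then have "w - z = int n *s (x - y)" using k by (simp add: algebra_simps)
    then have "alg_monom w - alg_monom z \<in> P" using * assms by blast
    then show ?thesis using ideal_closed(4)[OF ideal_P ideal_closed(2)[OF ideal_P]] by force
  qed
qed

lemma saturated_multiple:
  assumes saturated "g \<in> gp M" "p \<noteq> 0" "p *s g \<in> D"
  shows "g \<in> D"
proof -
  have "int (nat \<bar>p\<bar>) *s g \<in> D"
    using assms(4) D_closed(3)[OF assms(4)] by (cases "p \<ge> 0") auto
  then show ?thesis using assms(1-3) unfolding saturated_def by (metis zero_less_nat_eq zero_less_abs_iff)
qed

text \<open>To realise \<open>K[G/\<int>d]\<close> inside a ring of Laurent polynomials, fix a coordinate \<open>j\<close> with \<open>d\<^sub>j \<noteq> 0\<close> and send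
  \<open>z\<close> to \<open>d\<^sub>j z - z\<^sub>j d\<close>. On the whole lattice this linear map kills the vectors parallel to \<open>d\<close>, and on
  \<open>G\<close> those are the multiples of \<open>d\<close> by saturation.\<close>

lemma shift_regular_saturated_imp_prime:
  assumes shift_regular saturated
  shows "primeideal P R"
proof -
  obtain j where j: "(x - y) $ j \<noteq> 0" using neq by (auto simp: vec_eq_iff)
  define \<psi> where "\<psi> z = (x - y) $ j *s z - z $ j *s (x - y)" for z
  have add: "\<psi> (z + w) = \<psi> z + \<psi> w" for z w
    by (simp add: \<psi>_def int_vec.scale_left_distrib int_vec.scale_right_distrib)
  have diff: "\<psi> (z - w) = \<psi> z - \<psi> w" for z w
    using add[of "z - w" w] by simp
  have "map_kernel \<psi> \<subseteq> P"
  proof (rule map_kernel_subset_ideal[OF ideal_P])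
    fix z w assume zw: "z \<in> M" "w \<in> M" "\<psi> z = \<psi> w"
    then have "(x - y) $ j *s (z - w) = (z - w) $ j *s (x - y)"
      using diff[of z w] by (simp add: \<psi>_def)
    then have "(x - y) $ j *s (z - w) \<in> D" by blast
    moreover have "z - w \<in> gp M" using zw by (auto simp: gp_M)
    ultimately have "z - w \<in> D" using saturated_multiple assms(2) j by blast
    then show "alg_monom z - alg_monom w \<in> P" using congruent_binomial_mem assms(1) zw by blast
  qed
  moreover have "P \<subseteq> map_kernel \<psi>"
  proof (rule R.genideal_minimal)
    show "ideal (map_kernel \<psi>) R" using ideal_map_kernel add .
    have "\<psi> (x - y) = 0" by (simp add: \<psi>_def)
    then show "{alg_monom x - alg_monom y} \<subseteq> map_kernel \<psi>"
      using generator_closed diff[of x y] by (simp add: map_kernel_def monoid_algebra_map_diff)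
  qed
  ultimately show ?thesis using primeideal_map_kernel[of \<psi>] add by auto
qed

end

section \<open>Rank\<close>

lemma common_denominator:
  fixes q :: "'a \<Rightarrow> rat"
  assumes "finite B"
  shows "\<exists>D::int. D \<noteq> 0 \<and> (\<forall>b\<in>B. of_int D * q b \<in> \<int>)"
  using assms
proof induction
  case empty
  show ?case by (intro exI[of _ 1]) simp
next
  case (insert b B)
  then obtain D where D: "D \<noteq> 0" "\<forall>b\<in>B. of_int D * q b \<in> \<int>" by blast
  obtain n d where nd: "q b = of_int n / of_int d" "d > 0"
    by (metis quotient_of_div quotient_of_denom_pos surj_pair)
  have "of_int (d * D) * q b = of_int (n * D)" using nd by simp
  moreover have "of_int (d * D) * q c \<in> \<int>" if "c \<in> B" for c
    using Ints_mult[of "of_int d" "of_int D * q c"] D(2) that by (simp add: mult.assoc)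
  ultimately show ?case using D(1) nd(2) by (intro exI[of _ "d * D"]) (metis Ints_of_int insert_iff less_irrefl mult_eq_0_iff)
qed

text \<open>A rational relation between integer vectors becomes an integer relation after clearing denominators.\<close>

lemma int_independent_card_le:
  fixes B :: "(int ^ 'm) set"
  assumes "finite B" "\<not> int_vec.dependent B"
  shows "card B \<le> CARD('m)"
proof -
  define \<iota> :: "int ^ 'm \<Rightarrow> rat ^ 'm" where "\<iota> v = (\<chi> i. of_int (v $ i))" for v
  have inj: "inj \<iota>" by (rule injI) (simp add: \<iota>_def vec_eq_iff)
  then have inj_B: "inj_on \<iota> B" by (rule inj_on_subset) simp
  have "vec.independent (\<iota> ` B)"
  proof
    assume "vec.dependent (\<iota> ` B)"
    then obtain u b where u: "b \<in> B" "u (\<iota> b) \<noteq> 0" "(\<Sum>v\<in>\<iota> ` B. u v *s v) = 0"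
      using assms(1) by (auto simp: vec.dependent_finite)
    have sum: "(\<Sum>v\<in>B. u (\<iota> v) *s \<iota> v) = 0"
      using u(3) sum.reindex[OF inj_B, of "\<lambda>v. u v *s v"] by (simp only: comp_def)
    obtain D :: int where D: "D \<noteq> 0" "\<forall>v\<in>B. of_int D * u (\<iota> v) \<in> \<int>"
      using common_denominator[OF assms(1), of "\<lambda>v. u (\<iota> v)"] by blast
    then obtain c where c: "\<And>v. v \<in> B \<Longrightarrow> of_int D * u (\<iota> v) = of_int (c v)"
      unfolding Ints_def image_iff by metis
    have "(\<Sum>v\<in>B. c v *s v) = 0"
    proof (rule vec_eq_iff[THEN iffD2], rule allI)
      fix i
      have "of_int ((\<Sum>v\<in>B. c v *s v) $ i) = (\<Sum>v\<in>B. of_int (c v) * \<iota> v $ i)"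
        by (simp add: \<iota>_def)
      also have "\<dots> = (\<Sum>v\<in>B. of_int D * (u (\<iota> v) *s \<iota> v) $ i)"
        by (rule sum.cong) (simp_all add: c[symmetric])
      also have "\<dots> = of_int D * (\<Sum>v\<in>B. u (\<iota> v) *s \<iota> v) $ i"
        by (simp add: sum_distrib_left)
      also have "\<dots> = 0" unfolding sum by simp
      finally show "(\<Sum>v\<in>B. c v *s v) $ i = 0 $ i" by (simp only: of_int_eq_0_iff zero_index)
    qed
    then have "c b = 0" using assms u(1) by (auto simp: int_vec.dependent_finite)
    then show False using c[OF u(1)] D(1) u(2) by simp
  qed
  then have "card (\<iota> ` B) \<le> CARD('m)"
    using vec.independent_bound_general[of "\<iota> ` B"] dim_subset_UNIV_cart_gen[of "\<iota> ` B"] by linarith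
  then show ?thesis using card_image[OF inj_B] by simp
qed

lemma finite_independent_cards:
  "finite {card B | B. B \<subseteq> G \<and> finite B \<and> \<not> int_vec.dependent (B :: (int ^ 'm) set)}"
  by (rule finite_subset[of _ "{..CARD('m)}"]) (auto intro: int_independent_card_le)

lemma card_le_group_rank:
  assumes "B \<subseteq> G" "finite B" "\<not> int_vec.dependent B"
  shows "card B \<le> group_rank G"
  unfolding group_rank_def by (rule Max_ge[OF finite_independent_cards]) (use assms in blast)

lemma group_rank_attained:
  fixes G :: "(int ^ 'm) set"
  obtains B where "B \<subseteq> G" "finite B" "\<not> int_vec.dependent B" "card B = group_rank G"
proof -
  have "card ({} :: (int ^ 'm) set) \<in> {card B | B. B \<subseteq> G \<and> finite B \<and> \<not> int_vec.dependent B}"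
    using int_vec.independent_empty by blast
  then have "group_rank G \<in> {card B | B. B \<subseteq> G \<and> finite B \<and> \<not> int_vec.dependent B}"
    unfolding group_rank_def by (intro Max_in[OF finite_independent_cards]) (metis empty_iff)
  then obtain B where "B \<subseteq> G" "finite B" "\<not> int_vec.dependent B" "group_rank G = card B"
    unfolding mem_Collect_eq by (elim exE conjE)
  then show thesis by (intro that[of B]) simp_all
qed

text \<open>If \<open>u\<close> and \<open>v\<close> were independent, they would extend a lift of a maximal independent subset of the
  image to an independent set, and the rank would drop by at least 2.\<close>

lemma kernel_dependent_if_rank_drops_by_one:
  fixes \<Phi> :: "int ^ 'm \<Rightarrow> int ^ 'n"
  assumes zero: "0 \<in> G" and diff: "\<And>g h. g \<in> G \<Longrightarrow> h \<in> G \<Longrightarrow> g - h \<in> G"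
    and \<Phi>_diff: "\<And>g h. g \<in> G \<Longrightarrow> h \<in> G \<Longrightarrow> \<Phi> (g - h) = \<Phi> g - \<Phi> h"
    and rank: "group_rank G \<le> group_rank (\<Phi> ` G) + 1"
    and u: "u \<in> G" "\<Phi> u = 0" and v: "v \<in> G" "\<Phi> v = 0"
  shows "\<exists>p q. (p \<noteq> 0 \<or> q \<noteq> 0) \<and> p *s u + q *s v = 0"
proof (rule ccontr)
  assume "\<not> ?thesis"
  then have indep: "p = 0" "q = 0" if "p *s u + q *s v = 0" for p q
    using that by auto
  have \<Phi>_zero: "\<Phi> 0 = 0" using \<Phi>_diff[OF zero zero] by simp
  have minus: "- g \<in> G" "\<Phi> (- g) = - \<Phi> g" if "g \<in> G" for g
    using diff[OF zero that] \<Phi>_diff[OF zero that] \<Phi>_zero by simp_all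
  have add: "g + h \<in> G" "\<Phi> (g + h) = \<Phi> g + \<Phi> h" if "g \<in> G" "h \<in> G" for g h
    using diff[OF that(1) minus(1)[OF that(2)]] \<Phi>_diff[OF that(1) minus(1)[OF that(2)]] minus(2)[OF that(2)] by simp_all
  have nat_scale: "int n *s g \<in> G \<and> \<Phi> (int n *s g) = int n *s \<Phi> g" if "g \<in> G" for g n
    by (induction n) (use that zero \<Phi>_zero add in \<open>simp_all add: int_vec.scale_left_distrib\<close>)
  have scale: "k *s g \<in> G \<and> \<Phi> (k *s g) = k *s \<Phi> g" if "g \<in> G" for g k
  proof (cases k rule: int_cases2)
    case (nonneg n)
    then show ?thesis using nat_scale[OF that, of n] by simp
  next
    case (nonpos n)
    then show ?thesis using nat_scale[OF that, of n] minus[of "int n *s g"] by simp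
  qed
  have sum: "(\<Sum>b\<in>B. c b *s l b) \<in> G \<and> \<Phi> (\<Sum>b\<in>B. c b *s l b) = (\<Sum>b\<in>B. c b *s \<Phi> (l b))"
    if "\<And>b. b \<in> B \<Longrightarrow> l b \<in> G" for B :: "(int ^ 'n) set" and c l
    using that by (induction B rule: infinite_finite_induct) (auto simp: zero \<Phi>_zero add scale)
  obtain B where B: "B \<subseteq> \<Phi> ` G" "finite B" "\<not> int_vec.dependent B" "card B = group_rank (\<Phi> ` G)"
    by (rule group_rank_attained)
  define l where "l = inv_into G \<Phi>"
  have l: "l b \<in> G" "\<Phi> (l b) = b" if "b \<in> B" for b
    using B(1) that by (auto simp: l_def inv_into_into f_inv_into_f)
  have inj: "inj_on l B" by (metis inj_onI l(2))
  have "b \<noteq> 0" if "b \<in> B" for b using B(3) that int_vec.dependent_zero by blast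
  then have disjoint: "l ` B \<inter> {u, v} = {}" using l u(2) v(2) by fastforce
  have "u \<noteq> v"
  proof
    assume "u = v"
    then have "1 *s u + (- 1) *s v = 0" by simp
    then show False using indep(1)[of 1 "- 1"] by simp
  qed
  have "\<not> int_vec.dependent (l ` B \<union> {u, v})"
  proof
    assume "int_vec.dependent (l ` B \<union> {u, v})"
    then obtain c w where c: "w \<in> l ` B \<union> {u, v}" "c w \<noteq> 0" "(\<Sum>w\<in>l ` B \<union> {u, v}. c w *s w) = 0"
      using B(2) by (subst (asm) int_vec.dependent_finite) auto
    have "(\<Sum>w\<in>l ` B \<union> {u, v}. c w *s w) = (\<Sum>w\<in>l ` B. c w *s w) + (\<Sum>w\<in>{u, v}. c w *s w)"
      using B(2) disjoint by (intro sum.union_disjoint) auto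
    then have split: "(\<Sum>b\<in>B. c (l b) *s l b) + (c u *s u + c v *s v) = 0"
      using c(3) \<open>u \<noteq> v\<close> by (simp add: sum.reindex[OF inj])
    have "\<Phi> (c u *s u + c v *s v) = 0"
      using u v by (simp add: add scale)
    then have "(\<Sum>b\<in>B. c (l b) *s b) = \<Phi> ((\<Sum>b\<in>B. c (l b) *s l b) + (c u *s u + c v *s v))"
      using sum[of B l "\<lambda>b. c (l b)"] l u(1) v(1) add scale by simp
    then have "(\<Sum>b\<in>B. c (l b) *s b) = 0" using split \<Phi>_zero by simp
    then have "\<forall>b\<in>B. c (l b) = 0" using B(2,3) by (auto simp: int_vec.dependent_finite)
    moreover from this have "c u *s u + c v *s v = 0" using split by simp
    then have "c u = 0" "c v = 0" by (rule indep)+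
    ultimately show False using c(1,2) by auto
  qed
  moreover have "l ` B \<union> {u, v} \<subseteq> G" using l u v by auto
  ultimately have "card (l ` B \<union> {u, v}) \<le> group_rank G"
    using B(2) by (intro card_le_group_rank) auto
  moreover have "card (l ` B \<union> {u, v}) = group_rank (\<Phi> ` G) + 2"
    using B(2,4) disjoint \<open>u \<noteq> v\<close> by (simp add: card_Un_disjoint card_image[OF inj])
  ultimately show False using rank by simp
qed

section \<open>Finiteness of the fibres of a grading\<close>

lemma submonoid_additive_iff:
  "submonoid N (additive_monoid UNIV) \<longleftrightarrow> 0 \<in> N \<and> (\<forall>a\<in>N. \<forall>b\<in>N. a + b \<in> N)"
  by (auto simp: submonoid_def additive_monoid_def)

lemma submonoid_hull: "submonoid ((\<lambda>N. submonoid N (additive_monoid UNIV)) hull S) (additive_monoid UNIV)"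
proof (rule hull_in)
  fix T assume "\<forall>N\<in>T. submonoid N (additive_monoid UNIV)"
  then show "submonoid (\<Inter> T) (additive_monoid UNIV)"
    unfolding submonoid_additive_iff by blast
qed

lemma affine_monoid_closed:
  assumes "affine_monoid M"
  shows "0 \<in> M" "a \<in> M \<Longrightarrow> b \<in> M \<Longrightarrow> a + b \<in> M"
  using assms submonoid_hull unfolding affine_monoid_def submonoid_additive_iff by blast+

lemma nat_incseq_subseq:
  fixes k :: "nat \<Rightarrow> nat"
  shows "\<exists>r::nat \<Rightarrow> nat. strict_mono r \<and> (\<forall>i j. i \<le> j \<longrightarrow> k (r i) \<le> k (r j))"
proof -
  obtain r where r: "strict_mono r" "monoseq (\<lambda>n. k (r n))" using seq_monosub[of k] by blast
  consider "\<forall>i j. i \<le> j \<longrightarrow> k (r i) \<le> k (r j)" | "\<forall>i j. i \<le> j \<longrightarrow> k (r j) \<le> k (r i)"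
    using r(2) unfolding monoseq_def by blast
  then show ?thesis
  proof cases
    case 1
    show ?thesis by (rule exI[of _ r]) (use r(1) 1 in simp)
  next
    case 2
    obtain m where m: "\<And>n. k (r m) \<le> k (r n)"
      using ex_has_least_nat[of "\<lambda>_. True" 0 "\<lambda>n. k (r n)"] by auto
    have "strict_mono (\<lambda>n. r (n + m))" using r(1) by (simp add: strict_mono_def)
    moreover have "k (r (i + m)) \<le> k (r (j + m))" for i j
      using 2[rule_format, of m "i + m"] m[of "j + m"] by simp
    ultimately show ?thesis by (intro exI[of _ "\<lambda>n. r (n + m)"]) simp
  qed
qed

text \<open>This is Dickson's lemma, stated without coordinates: the relation \<open>v - u \<in> N\<close> is a well-quasi-order on a finitely
  generated monoid \<open>N\<close>. Each generator contributes a multiplicity in the natural numbers, for which one passes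
  to a nondecreasing subsequence.\<close>

lemma hull_increasing_subseq:
  fixes S :: "(int ^ 'm) set" and f :: "nat \<Rightarrow> int ^ 'm"
  defines "N \<equiv> \<lambda>S. (\<lambda>N. submonoid N (additive_monoid UNIV)) hull S"
  assumes "finite S" "\<And>i. f i \<in> N S"
  shows "\<exists>r::nat \<Rightarrow> nat. strict_mono r \<and> (\<forall>i j. i \<le> j \<longrightarrow> f (r j) - f (r i) \<in> N S)"
  using assms(2,3)
proof (induction arbitrary: f)
  case empty
  have "N {} \<subseteq> {0}" unfolding N_def by (rule hull_minimal) (auto simp: submonoid_additive_iff)
  then have "f i = 0" for i using empty by blast
  moreover have "0 \<in> N {}" using submonoid_hull unfolding N_def submonoid_additive_iff by blast
  ultimately show ?case by (intro exI[of _ id]) (simp add: strict_mono_def)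
next
  case (insert s S)
  have closed: "0 \<in> N T" "a \<in> N T \<Longrightarrow> b \<in> N T \<Longrightarrow> a + b \<in> N T" for T a b
    using submonoid_hull unfolding N_def submonoid_additive_iff by blast+
  have scale: "int n *s s \<in> N (insert s S)" for n
  proof (induction n)
    case (Suc n)
    have "s \<in> N (insert s S)" unfolding N_def by (rule hull_inc) simp
    with Suc show ?case using closed by (simp add: int_vec.scale_left_distrib)
  qed (simp add: closed)
  have "N (insert s S) \<subseteq> {int n *s s + a | n a. a \<in> N S}" (is "_ \<subseteq> ?T")
    unfolding N_def
  proof (rule hull_minimal)
    have "int 1 *s s + 0 \<in> ?T" using closed(1) by blast
    moreover have "int 0 *s s + a \<in> ?T" if "a \<in> S" for a
      using that hull_inc[of a S] unfolding N_def by blast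
    ultimately show "insert s S \<subseteq> {int n *s s + a |n a. a \<in> (\<lambda>N. submonoid N (additive_monoid UNIV)) hull S}"
      unfolding N_def by auto
    have "int 0 *s s + 0 \<in> ?T" using closed(1) by blast
    moreover have "a + b \<in> ?T" if ab: "a \<in> ?T" "b \<in> ?T" for a b
    proof -
      obtain n m a' b' where "a = int n *s s + a'" "b = int m *s s + b'" "a' \<in> N S" "b' \<in> N S"
        using ab by blast
      then have "a + b = int (n + m) *s s + (a' + b')" "a' + b' \<in> N S"
        using closed(2) by (simp_all add: int_vec.scale_left_distrib algebra_simps)
      then show ?thesis by blast
    qed
    ultimately show "submonoid {int n *s s + a |n a. a \<in> (\<lambda>N. submonoid N (additive_monoid UNIV)) hull S} (additive_monoid UNIV)"
      unfolding N_def submonoid_additive_iff by simp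
  qed
  then have "\<forall>i. \<exists>n a. f i = int n *s s + a \<and> a \<in> N S" using insert.prems by blast
  then obtain k a where ka: "\<And>i. f i = int (k i) *s s + a i" "\<And>i. a i \<in> N S" by metis
  obtain r :: "nat \<Rightarrow> nat" where r: "strict_mono r" "\<And>i j. i \<le> j \<Longrightarrow> k (r i) \<le> k (r j)"
    using nat_incseq_subseq[of k] by blast
  obtain t :: "nat \<Rightarrow> nat" where t: "strict_mono t" "\<And>i j. i \<le> j \<Longrightarrow> a (r (t j)) - a (r (t i)) \<in> N S"
    using insert.IH[of "\<lambda>i. a (r i)"] ka(2) by blast
  have "f (r (t j)) - f (r (t i)) \<in> N (insert s S)" if "i \<le> j" for i j
  proof -
    have "k (r (t i)) \<le> k (r (t j))" using r(2) t(1) that by (simp add: strict_mono_less_eq)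
    then have "f (r (t j)) - f (r (t i)) = int (k (r (t j)) - k (r (t i))) *s s + (a (r (t j)) - a (r (t i)))"
      by (simp add: ka(1) int_vec.scale_left_diff_distrib algebra_simps)
    moreover have "N S \<subseteq> N (insert s S)" unfolding N_def by (rule hull_mono) blast
    ultimately show ?thesis using scale t(2)[OF that] closed(2) by (metis subsetD)
  qed
  moreover have "strict_mono (\<lambda>i. r (t i))" using r(1) t(1) by (simp add: strict_mono_def)
  ultimately show ?case by (intro exI[of _ "\<lambda>i. r (t i)"]) simp
qed

text \<open>Two distinct elements of an infinite fibre could be chosen with their difference in \<open>M\<close>. That difference
  has degree 0, so it is 0.\<close>

lemma finite_fibre:
  fixes \<delta> :: "int ^ 'm \<Rightarrow> int ^ 'e"
  assumes M: "affine_monoid M"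
    and add: "\<And>a b. a \<in> M \<Longrightarrow> b \<in> M \<Longrightarrow> \<delta> (a + b) = \<delta> a + \<delta> b"
    and zero: "\<And>a. a \<in> M \<Longrightarrow> \<delta> a = 0 \<Longrightarrow> a = 0"
  shows "finite {z \<in> M. \<delta> z = h}"
proof (rule ccontr)
  assume "infinite {z \<in> M. \<delta> z = h}"
  then obtain f :: "nat \<Rightarrow> int ^ 'm" where f: "inj f" "range f \<subseteq> {z \<in> M. \<delta> z = h}"
    using infinite_countable_subset by blast
  obtain S where S: "finite S" "M = (\<lambda>N. submonoid N (additive_monoid UNIV)) hull S"
    using M unfolding affine_monoid_def by blast
  obtain r :: "nat \<Rightarrow> nat" where r: "strict_mono r" "\<And>i j. i \<le> j \<Longrightarrow> f (r j) - f (r i) \<in> M"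
    using hull_increasing_subseq[OF S(1), of f] f(2) S(2) by blast
  have "f (r 1) - f (r 0) \<in> M" using r(2) by simp
  moreover have "f (r 0) \<in> M" "\<delta> (f (r 0)) = h" "\<delta> (f (r 1)) = h" using f(2) by auto
  ultimately have "f (r 1) = f (r 0)"
    using add[of "f (r 1) - f (r 0)" "f (r 0)"] zero[of "f (r 1) - f (r 0)"] by simp
  then show False using f(1) r(1) by (simp add: inj_eq strict_mono_eq)
qed

section \<open>Quotients of rank one less\<close>

locale binomial_quotient = binomial K M x y for K :: "'k::idom itself" and M :: "(int ^ 'm) set" and x y +
  fixes \<phi> :: "int ^ 'm \<Rightarrow> int ^ 'n"
  assumes \<phi>_add: "z \<in> M \<Longrightarrow> w \<in> M \<Longrightarrow> \<phi> (z + w) = \<phi> z + \<phi> w"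
    and \<phi>_eq: "\<phi> x = \<phi> y"
    and rank_drop: "monoid_rank M = monoid_rank (\<phi> ` M) + 1"
begin

lemma \<phi>_zero: "\<phi> 0 = 0"
  using \<phi>_add[OF zero_mem zero_mem] by simp

lemma image_closed: "0 \<in> \<phi> ` M" "a \<in> \<phi> ` M \<Longrightarrow> b \<in> \<phi> ` M \<Longrightarrow> a + b \<in> \<phi> ` M"
  using zero_mem \<phi>_zero add_mem by (force, force simp: \<phi>_add[symmetric])

lemma P_subset_map_kernel: "P \<subseteq> map_kernel \<phi>"
proof (rule R.genideal_minimal)
  show "ideal (map_kernel \<phi>) R" using ideal_map_kernel \<phi>_add .
  show "{alg_monom x - alg_monom y} \<subseteq> map_kernel \<phi>"
    using generator_closed \<phi>_eq by (simp add: map_kernel_def monoid_algebra_map_diff)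
qed

text \<open>The extension \<open>\<Phi>\<close> of \<open>\<phi>\<close> to the groups of differences lowers the rank by 1, so two elements \<open>z - w\<close> and
  \<open>x - y\<close> of its kernel are linearly dependent. Hence a nonzero multiple of \<open>z - w\<close> lies in \<open>D\<close>, and
  by saturation so does \<open>z - w\<close>.\<close>

lemma kernel_congruent:
  assumes saturated "z \<in> M" "w \<in> M" "\<phi> z = \<phi> w"
  shows "z - w \<in> D"
proof -
  define \<Phi> where "\<Phi> g = (let (a, b) = (SOME (a, b). a \<in> M \<and> b \<in> M \<and> g = a - b) in \<phi> a - \<phi> b)" for g
  have \<Phi>: "\<Phi> (a - b) = \<phi> a - \<phi> b" if ab: "a \<in> M" "b \<in> M" for a b
  proof -
    obtain a' b' where *: "(SOME (a', b'). a' \<in> M \<and> b' \<in> M \<and> a - b = a' - b') = (a', b')" by fastforce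
    have "case (a', b') of (a', b') \<Rightarrow> a' \<in> M \<and> b' \<in> M \<and> a - b = a' - b'"
      unfolding *[symmetric] by (rule someI[of _ "(a, b)"]) (use ab in simp)
    then have a'b': "a' \<in> M" "b' \<in> M" "a + b' = a' + b" by (auto simp: algebra_simps)
    then have "\<phi> a + \<phi> b' = \<phi> a' + \<phi> b" using \<phi>_add ab by metis
    then have "\<phi> a' - \<phi> b' = \<phi> a - \<phi> b" by (simp add: algebra_simps)
    then show ?thesis unfolding \<Phi>_def Let_def * by simp
  qed
  have diff: "g - h \<in> gp M \<and> \<Phi> (g - h) = \<Phi> g - \<Phi> h" if gh: "g \<in> gp M" "h \<in> gp M" for g h
  proof -
    obtain a b a' b' where ab: "a \<in> M" "b \<in> M" "a' \<in> M" "b' \<in> M" "g = a - b" "h = a' - b'"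
      using gh unfolding gp_M by blast
    then have eq: "g - h = (a + b') - (b + a')" and mem: "a + b' \<in> M" "b + a' \<in> M" by (simp_all add: add_mem)
    have "\<Phi> (g - h) = \<Phi> g - \<Phi> h" unfolding eq using ab mem by (simp add: \<Phi> \<phi>_add)
    moreover have "g - h \<in> gp M" unfolding eq gp_M using mem by blast
    ultimately show ?thesis by blast
  qed
  have "gp (\<phi> ` M) = {a - b | a b. a \<in> \<phi> ` M \<and> b \<in> \<phi> ` M}"
    by (rule gp_eq_differences) (simp_all add: image_closed)
  then have "\<Phi> ` gp M = gp (\<phi> ` M)"
    by (force simp: gp_M \<Phi> image_iff)
  then have rank: "group_rank (gp M) \<le> group_rank (\<Phi> ` gp M) + 1"
    using rank_drop by (simp add: monoid_rank_def)
  have "\<exists>p q. (p \<noteq> 0 \<or> q \<noteq> 0) \<and> p *s (z - w) + q *s (x - y) = 0"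
  proof (rule kernel_dependent_if_rank_drops_by_one[OF _ _ _ rank])
    show "0 \<in> gp M" using zero_mem M_subset_gp by blast
    show "z - w \<in> gp M" "x - y \<in> gp M" using assms x_mem y_mem by (auto simp: gp_M)
    show "\<Phi> (z - w) = 0" "\<Phi> (x - y) = 0" using assms x_mem y_mem \<phi>_eq by (simp_all add: \<Phi>)
  qed (use diff in blast)+
  then obtain p q where pq: "p \<noteq> 0 \<or> q \<noteq> 0" "p *s (z - w) + q *s (x - y) = 0" by blast
  have "p \<noteq> 0"
  proof
    assume "p = 0"
    then have "q \<noteq> 0" "q *s (x - y) = 0" using pq by simp_all
    then show False using neq by (simp add: vec_eq_iff)
  qed
  moreover have "p *s (z - w) = (- q) *s (x - y)"
    using pq(2) by (simp add: add_eq_0_iff)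
  then have "p *s (z - w) \<in> D" by blast
  moreover have "z - w \<in> gp M" using assms by (auto simp: gp_M)
  ultimately show ?thesis using saturated_multiple assms(1) by blast
qed

lemma prime_iff_map_kernel: "primeideal P R \<longleftrightarrow> map_kernel \<phi> = P"
proof
  assume prime: "primeideal P R"
  have "map_kernel \<phi> \<subseteq> P"
  proof (rule map_kernel_subset_ideal[OF ideal_P])
    fix z w assume "z \<in> M" "w \<in> M" "\<phi> z = \<phi> w"
    then show "alg_monom z - alg_monom w \<in> P"
      by (intro congruent_binomial_mem kernel_congruent
          prime_imp_saturated[OF prime] prime_imp_shift_regular[OF prime])
  qed
  with P_subset_map_kernel show "map_kernel \<phi> = P" by blast
next
  assume "map_kernel \<phi> = P"
  with primeideal_map_kernel[of \<phi>] \<phi>_add show "primeideal P R" by simp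
qed

end

section \<open>Hilbert series\<close>

lemma laurent_mult_one_minus_monom:
  fixes g h :: "int ^ 'e"
  shows "laurent_mult (1 - alg_monom g) H h = H h - H (h - g)"
proof -
  let ?p = "1 - alg_monom g :: (int ^ 'e) \<Rightarrow>\<^sub>0 int"
  have lookup: "Poly_Mapping.lookup ?p k = (if k = 0 then 1 else 0) - (if k = g then 1 else 0)" for k
    by (simp add: lookup_minus lookup_one alg_monom_def lookup_single when_def)
  have "Poly_Mapping.keys ?p \<subseteq> {0, g}"
    by (auto simp: in_keys_iff lookup split: if_splits)
  then have "laurent_mult ?p H h = (\<Sum>k\<in>{0, g}. Poly_Mapping.lookup ?p k * H (h - k))"
    unfolding laurent_mult_def by (rule sum.mono_neutral_left[rotated]) (auto simp: in_keys_iff)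
  then show ?thesis by (cases "g = 0") (simp_all add: lookup alg_monom_zero)
qed

context binomial_quotient
begin

text \<open>Two elements with the same image differ by \<open>k d\<close>. For \<open>k \<noteq> 0\<close> one of the two would lie in \<open>x + M\<close>.\<close>

lemma prime_imp_inj_on:
  assumes prime: "primeideal P R"
  shows "inj_on \<phi> (M - (+) x ` M)"
proof (rule inj_onI)
  fix z w assume z: "z \<in> M - (+) x ` M" and w: "w \<in> M - (+) x ` M" and eq: "\<phi> z = \<phi> w"
  note regular = shift_regular_iterated[OF prime_imp_shift_regular[OF prime]]
  obtain k where k: "z - w = k *s (x - y)"
    using kernel_congruent[OF prime_imp_saturated[OF prime]] z w eq by blast
  show "z = w"
  proof (cases k rule: int_cases3)
    case zero
    with k show ?thesis by simp
  next
    case (pos n)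
    then have "z - w = int (Suc (n - 1)) *s (x - y)" using k by simp
    then show ?thesis using regular[of z w] z w by blast
  next
    case (neg n)
    then have "- (z - w) = int (Suc (n - 1)) *s (x - y)" unfolding k by simp
    then have "w - z = int (Suc (n - 1)) *s (x - y)" by simp
    then show ?thesis using regular[of w z] z w by blast
  qed
qed

text \<open>As long as an element lies in \<open>x + M\<close>, subtracting \<open>d\<close> keeps it in \<open>M\<close>, fixes its image and changes its
  monomial by an element of \<open>P\<close>. The elements met on the way are distinct members of one fibre,
  so the descent stops.\<close>

lemma terminal_representative:
  assumes z: "z \<in> M" and fin: "finite {w \<in> M. \<phi> w = \<phi> z}"
  shows "\<exists>t\<in>M - (+) x ` M. \<phi> t = \<phi> z \<and> alg_monom z - alg_monom t \<in> P"
proof (rule ccontr)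
  assume none: "\<not> ?thesis"
  have step: "v - (x - y) \<in> M \<and> \<phi> (v - (x - y)) = \<phi> z \<and> alg_monom z - alg_monom (v - (x - y)) \<in> P"
    if v: "v \<in> M" "\<phi> v = \<phi> z" "alg_monom z - alg_monom v \<in> P" for v
  proof -
    obtain u where u: "u \<in> M" "v = x + u" using none v by auto
    then have "alg_monom z - alg_monom (v - (x - y)) = (alg_monom z - alg_monom v) + alg_monom u * (alg_monom x - alg_monom y :: (int ^ 'm) \<Rightarrow>\<^sub>0 'k)"
      by (simp add: right_diff_distrib alg_monom_mult add.commute)
    moreover have "alg_monom u * (alg_monom x - alg_monom y) \<in> P"
      using ideal_closed(5)[OF ideal_P generator_mem] u by simp
    ultimately have "alg_monom z - alg_monom (v - (x - y)) \<in> P"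
      using ideal_closed(3)[OF ideal_P v(3)] by (simp only:)
    moreover have "v - (x - y) = u + y" using u by simp
    moreover have "\<phi> (u + y) = \<phi> z" using u v \<phi>_add x_mem y_mem \<phi>_eq by (simp add: add.commute)
    ultimately show ?thesis using u y_mem add_mem by simp
  qed
  have "z - int n *s (x - y) \<in> M \<and> \<phi> (z - int n *s (x - y)) = \<phi> z \<and> alg_monom z - alg_monom (z - int n *s (x - y)) \<in> P" for n
  proof (induction n)
    case 0
    show ?case using z ideal_closed(2)[OF ideal_P] by simp
  next
    case (Suc n)
    have succ: "z - int (Suc n) *s (x - y) = z - int n *s (x - y) - (x - y)"
      by (simp add: int_vec.scale_left_distrib)
    show ?case unfolding succ using Suc by (intro step) blast+
  qed
  then have "range (\<lambda>n. z - int n *s (x - y)) \<subseteq> {w \<in> M. \<phi> w = \<phi> z}" by blast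
  moreover have "inj (\<lambda>n. z - int n *s (x - y))"
  proof (rule injI)
    fix n m assume "z - int n *s (x - y) = z - int m *s (x - y)"
    then have "int n *s (x - y) = int m *s (x - y)" by simp
    moreover obtain i where "(x - y) $ i \<noteq> 0" using neq by (auto simp: vec_eq_iff)
    ultimately show "n = m" by (metis mult_right_cancel of_nat_eq_iff vector_smult_component)
  qed
  ultimately show False using fin range_inj_infinite finite_subset by blast
qed

text \<open>Let \<open>g = deg (\<phi> x)\<close>. In degree \<open>h\<close> the product of the Hilbert series of \<open>M\<close> with \<open>1 - T^g\<close> counts the set \<open>T h\<close> of elements
  outside \<open>x + M\<close>, because translation by \<open>x\<close> identifies degree \<open>h - g\<close> of \<open>M\<close> with the rest. The image
  of \<open>T h\<close> is all of degree \<open>h\<close> of \<open>\<phi> ` M\<close>, so equality of the two series means that \<open>\<phi>\<close> is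
  injective on each \<open>T h\<close>.\<close>

lemma prime_iff_hilbert_series:
  fixes deg :: "int ^ 'n \<Rightarrow> int ^ 'e"
  assumes M: "affine_monoid M"
    and deg_add: "\<And>a b. a \<in> \<phi> ` M \<Longrightarrow> b \<in> \<phi> ` M \<Longrightarrow> deg (a + b) = deg a + deg b"
    and deg_zero: "\<And>a. a \<in> \<phi> ` M \<Longrightarrow> deg a = 0 \<Longrightarrow> a = 0"
    and \<phi>_nonzero: "\<And>z. z \<in> M \<Longrightarrow> \<phi> z = 0 \<Longrightarrow> z = 0"
  shows "primeideal P R \<longleftrightarrow>
    hilbert_series (\<phi> ` M) deg = laurent_mult (1 - alg_monom (deg (\<phi> x))) (hilbert_series M (\<lambda>z. deg (\<phi> z)))"
proof -
  let ?\<delta> = "\<lambda>z. deg (\<phi> z)"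
  have \<delta>_add: "?\<delta> (z + w) = ?\<delta> z + ?\<delta> w" if "z \<in> M" "w \<in> M" for z w
    using that deg_add \<phi>_add by simp
  have fin: "finite {z \<in> M. ?\<delta> z = h}" for h
    by (rule finite_fibre[OF M]) (use \<delta>_add deg_zero \<phi>_nonzero in auto)
  define T where "T h = {z \<in> M - (+) x ` M. ?\<delta> z = h}" for h
  have terminal: "\<exists>t\<in>M - (+) x ` M. \<phi> t = \<phi> z \<and> alg_monom z - alg_monom t \<in> P" if "z \<in> M" for z
    by (rule terminal_representative[OF that finite_subset[OF _ fin[of "?\<delta> z"]]]) auto
  have finT: "finite (T h)" for h
    by (rule finite_subset[OF _ fin[of h]]) (auto simp: T_def)
  have image: "\<phi> ` T h = {w \<in> \<phi> ` M. deg w = h}" for h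
  proof
    show "{w \<in> \<phi> ` M. deg w = h} \<subseteq> \<phi> ` T h"
    proof clarify
      fix z assume "z \<in> M" "h = deg (\<phi> z)"
      moreover from terminal[OF this(1)] obtain t where "t \<in> M - (+) x ` M" "\<phi> t = \<phi> z" by blast
      ultimately show "\<phi> z \<in> \<phi> ` T (deg (\<phi> z))" unfolding T_def by (intro image_eqI[of _ _ t]) auto
    qed
  qed (auto simp: T_def)
  have card: "int (card (T h)) = hilbert_series M ?\<delta> h - hilbert_series M ?\<delta> (h - ?\<delta> x)" for h
  proof -
    let ?S = "(+) x ` {z \<in> M. ?\<delta> z = h - ?\<delta> x}"
    have "{z \<in> M. ?\<delta> z = h} = T h \<union> ?S"
      using x_mem add_mem by (auto simp: T_def \<delta>_add image_iff)
    moreover have "T h \<inter> ?S = {}" by (auto simp: T_def)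
    moreover have "card ?S = card {z \<in> M. ?\<delta> z = h - ?\<delta> x}" by (simp add: card_image)
    ultimately show ?thesis
      using card_Un_disjoint[of "T h" ?S] finT fin by (simp add: hilbert_series_def)
  qed
  have "hilbert_series (\<phi> ` M) deg = laurent_mult (1 - alg_monom (deg (\<phi> x))) (hilbert_series M ?\<delta>)
      \<longleftrightarrow> (\<forall>h. int (card {w \<in> \<phi> ` M. deg w = h}) = int (card (T h)))"
    unfolding fun_eq_iff laurent_mult_one_minus_monom card by (simp add: hilbert_series_def)
  also have "\<dots> \<longleftrightarrow> (\<forall>h. card (\<phi> ` T h) = card (T h))" by (simp add: image)
  also have "\<dots> \<longleftrightarrow> (\<forall>h. inj_on \<phi> (T h))" using inj_on_iff_eq_card[OF finT] by blast
  also have "\<dots> \<longleftrightarrow> inj_on \<phi> (M - (+) x ` M)"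
  proof
    assume inj: "\<forall>h. inj_on \<phi> (T h)"
    show "inj_on \<phi> (M - (+) x ` M)"
    proof (rule inj_onI)
      fix z w assume "z \<in> M - (+) x ` M" "w \<in> M - (+) x ` M" and eq: "\<phi> z = \<phi> w"
      then have "z \<in> T (?\<delta> z)" "w \<in> T (?\<delta> z)" by (simp_all add: T_def)
      with inj_onD[OF inj[rule_format] eq] show "z = w" by blast
    qed
  next
    assume inj: "inj_on \<phi> (M - (+) x ` M)"
    have "T h \<subseteq> M - (+) x ` M" for h by (auto simp: T_def)
    then show "\<forall>h. inj_on \<phi> (T h)" by (intro allI inj_on_subset[OF inj])
  qed
  also have "\<dots> \<longleftrightarrow> primeideal P R"
  proof
    assume inj: "inj_on \<phi> (M - (+) x ` M)"
    have "map_kernel \<phi> \<subseteq> P"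
    proof (rule map_kernel_subset_ideal[OF ideal_P])
      fix z w assume zw: "z \<in> M" "w \<in> M" "\<phi> z = \<phi> w"
      obtain t where t: "t \<in> M - (+) x ` M" "\<phi> t = \<phi> z" "alg_monom z - alg_monom t \<in> P"
        using terminal zw(1) by blast
      obtain s where s: "s \<in> M - (+) x ` M" "\<phi> s = \<phi> w" "alg_monom w - alg_monom s \<in> P"
        using terminal zw(2) by blast
      have "t = s" using inj_onD[OF inj _ t(1) s(1)] t(2) s(2) zw(3) by simp
      then show "alg_monom z - alg_monom w \<in> P" using ideal_closed(4)[OF ideal_P t(3) s(3)] by simp
    qed
    with P_subset_map_kernel show "primeideal P R" unfolding prime_iff_map_kernel by blast
  qed (rule prime_imp_inj_on)
  finally show ?thesis by blast
qed

end

section \<open>The equivalences\<close>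

theorem theorem2p1:
  fixes M :: "(int ^ 'm) set" and x y :: "int ^ 'm"
  assumes "affine_monoid M"
    and "x \<in> M" and "y \<in> M"
    and "- x \<notin> M" and "- y \<notin> M"
    and "x \<noteq> y"
  shows
    "(primeideal (genideal (monoid_algebra TYPE('k::field) M) {alg_monom x - alg_monom y})
        (monoid_algebra TYPE('k) M)
      \<longleftrightarrow>
      regular_sequence (monoid_algebra TYPE('k) M) [alg_monom x, alg_monom y] \<and>
      torsionfree (additive_monoid (gp M) Mod range (\<lambda>k::int. k *s (x - y))))
     \<and>
     (\<forall>(M' :: (int ^ 'n) set) \<phi>.
        affine_monoid M' \<and> \<phi> \<in> epi (additive_monoid M) (additive_monoid M') \<and>
        monoid_rank M = monoid_rank M' + 1 \<and> \<phi> x = \<phi> y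
        \<longrightarrow>
        (primeideal (genideal (monoid_algebra TYPE('k) M) {alg_monom x - alg_monom y})
           (monoid_algebra TYPE('k) M)
         \<longleftrightarrow>
         a_kernel (monoid_algebra TYPE('k) M) (monoid_algebra TYPE('k) M') (monoid_algebra_map \<phi>)
           = genideal (monoid_algebra TYPE('k) M) {alg_monom x - alg_monom y})
        \<and>
        (\<forall>deg :: int ^ 'n \<Rightarrow> int ^ 'e.
           positive_multigrading M' deg \<and> (\<forall>z\<in>M. z \<noteq> 0 \<longrightarrow> \<phi> z \<noteq> 0)
           \<longrightarrow>
           (primeideal (genideal (monoid_algebra TYPE('k) M) {alg_monom x - alg_monom y})
              (monoid_algebra TYPE('k) M)
            \<longleftrightarrow>
            hilbert_series M' deg =
              laurent_mult (1 - alg_monom (deg (\<phi> x))) (hilbert_series M (\<lambda>z. deg (\<phi> z))))))"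
proof -
  interpret binomial "TYPE('k)" M x y
    by unfold_locales (use assms affine_monoid_closed in auto)
  have prime_iff: "primeideal P R \<longleftrightarrow> regular_sequence R [alg_monom x, alg_monom y] \<and>
      torsionfree (additive_monoid (gp M) Mod D)"
    unfolding regular_sequence_iff torsionfree_iff_saturated
    using prime_imp_shift_regular prime_imp_saturated shift_regular_saturated_imp_prime by blast
  have quotient: "(primeideal P R \<longleftrightarrow> a_kernel R (monoid_algebra TYPE('k) M') (monoid_algebra_map \<phi>) = P) \<and>
      (\<forall>deg :: int ^ 'n \<Rightarrow> int ^ 'e.
         positive_multigrading M' deg \<and> (\<forall>z\<in>M. z \<noteq> 0 \<longrightarrow> \<phi> z \<noteq> 0) \<longrightarrow>
         (primeideal P R \<longleftrightarrow> hilbert_series M' deg =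
            laurent_mult (1 - alg_monom (deg (\<phi> x))) (hilbert_series M (\<lambda>z. deg (\<phi> z)))))"
    if hyps: "affine_monoid M' \<and> \<phi> \<in> epi (additive_monoid M) (additive_monoid M') \<and>
        monoid_rank M = monoid_rank M' + 1 \<and> \<phi> x = \<phi> y"
    for M' :: "(int ^ 'n) set" and \<phi> :: "int ^ 'm \<Rightarrow> int ^ 'n"
  proof -
    have image: "M' = \<phi> ` M" and add: "\<And>z w. z \<in> M \<Longrightarrow> w \<in> M \<Longrightarrow> \<phi> (z + w) = \<phi> z + \<phi> w"
      using hyps by (auto simp: epi_def hom_def additive_monoid_def)
    interpret binomial_quotient "TYPE('k)" M x y \<phi>
      by unfold_locales (use hyps add image in auto)
    have "a_kernel R (monoid_algebra TYPE('k) M') (monoid_algebra_map \<phi>) = map_kernel \<phi>"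
      by (simp add: a_kernel_def' map_kernel_def monoid_algebra_def)
    moreover have "primeideal P R \<longleftrightarrow> hilbert_series M' deg =
            laurent_mult (1 - alg_monom (deg (\<phi> x))) (hilbert_series M (\<lambda>z. deg (\<phi> z)))"
      if deg: "positive_multigrading M' deg" "\<forall>z\<in>M. z \<noteq> 0 \<longrightarrow> \<phi> z \<noteq> 0"
      for deg :: "int ^ 'n \<Rightarrow> int ^ 'e"
    proof -
      have "M' \<subseteq> gp M'" unfolding gp_def by (auto intro: generate.incl)
      then have deg_add: "deg (a + b) = deg a + deg b" if "a \<in> M'" "b \<in> M'" for a b
        using deg(1) that unfolding positive_multigrading_def multigrading_def hom_def additive_monoid_def by auto
      have deg_zero: "a = 0" if "a \<in> M'" "deg a = 0" for a
        using deg(1) that unfolding positive_multigrading_def by blast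
      show ?thesis
        unfolding image
        by (rule prime_iff_hilbert_series[OF assms(1)]) (use deg_add deg_zero deg(2) image in blast)+
    qed
    ultimately show ?thesis using prime_iff_map_kernel by simp
  qed
  show ?thesis using prime_iff quotient by blast
qed

end
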